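(* Let $\eta \in S_5$ be the permutation $i \mapsto 6-i$ (the longest element of $S_5$), and let $\mathrm{BL}_\eta = \mathrm{Lo}_5^1 \cap \mathrm{Bru}^{\mathrm{GL}}_\eta$, with its topology as a subspace of the space of real $5\times 5$ matrices. Then $\mathrm{BL}_\eta$ has exactly $52$ connected components, and every connected component of $\mathrm{BL}_\eta$ is contractible.
   Context: $\mathrm{GL}_5$ is the group of real invertible $5\times 5$ matrices and $\mathrm{Up}_5\subset \mathrm{GL}_5$ is the subgroup of invertible upper triangular matrices. $\mathrm{Lo}_5^1$ is the group of real lower triangular $5\times 5$ matrices with all diagonal entries equal to $1$. For $\sigma\in S_5$, $P_\sigma$ is the permutation matrix with $(i,\sigma(i))$ entries equal to $1$ and all other entries $0$, and the Bruhat cell of $\sigma$ is $\mathrm{Bru}^{\mathrm{GL}}_\sigma=\{U_0P_\sigma U_1 : U_0,U_1\in \mathrm{Up}_5\}\subset \mathrm{GL}_5$. The set $\mathrm{BL}_\eta$ is homeomorphic to the intersection of two open (top-dimensional) real Bruhat cells in general position, for $n=4$ (that is, for $5\times5$ matrices). *)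

theory Defs
  imports "HOL-Analysis.Analysis"
begin

text \<open>
  Matrix indices live in the type \<open>5\<close>, whose elements are ordered as \<open>0 < 1 < 2 < 3 < 4\<close>;
  position \<open>i\<close> of the usual numbering \<open>1, \<dots>, 5\<close> is the element \<open>i - 1\<close> of this type.
  Note that \<open>5 = 0\<close> in this type, so the usual numbering must not be used directly.
\<close>

type_synonym 'n rmat = "real^'n^'n"

definition GL :: "('n::finite) rmat set" where
  "GL = {A. invertible A}"

definition Up :: "('n::{finite,linorder}) rmat set" where
  "Up = {U \<in> GL. \<forall>i j. j < i \<longrightarrow> U $ i $ j = 0}"

definition Lo1 :: "('n::{finite,linorder}) rmat set" where
  "Lo1 = {L. (\<forall>i j. i < j \<longrightarrow> L $ i $ j = 0) \<and> (\<forall>i. L $ i $ i = 1)}"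

definition perm_matrix :: "('n \<Rightarrow> 'n) \<Rightarrow> ('n::finite) rmat" where
  "perm_matrix \<sigma> = (\<chi> i j. if j = \<sigma> i then 1 else 0)"

definition Bruhat_cell :: "('n \<Rightarrow> 'n) \<Rightarrow> ('n::{finite,linorder}) rmat set" where
  "Bruhat_cell \<sigma> = {U0 ** perm_matrix \<sigma> ** U1 | U0 U1. U0 \<in> Up \<and> U1 \<in> Up}"

definition BL :: "('n \<Rightarrow> 'n) \<Rightarrow> ('n::{finite,linorder}) rmat set" where
  "BL \<sigma> = Lo1 \<inter> Bruhat_cell \<sigma>"

text \<open>The map \<open>i \<mapsto> 6 - i\<close> on \<open>1, \<dots>, 5\<close> becomes \<open>i \<mapsto> 4 - i\<close> on \<open>0, \<dots>, 4\<close>.\<close>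

definition \<eta> :: "5 \<Rightarrow> 5" where
  "\<eta> i = 4 - i"

lemma index_order: "(0 :: 5) < 1" "(1 :: 5) < 2" "(2 :: 5) < 3" "(3 :: 5) < 4"
  by (simp_all add: less_bit1_def bit1.Rep_0 bit1.Rep_1 bit1.Rep_numeral)

lemma eta_permutes: "\<eta> permutes UNIV"
  by (rule bij_imp_permutes) (auto intro!: bij_betwI[where g = \<eta>] simp: \<eta>_def)

lemma Rep_eta: "Rep_bit1 (\<eta> i) = 4 - Rep_bit1 i"
proof -
  have "0 \<le> Rep_bit1 i" "Rep_bit1 i < 5"
    using Rep_bit1[of i] by auto
  moreover have "Rep_bit1 (4 :: 5) = 4"
    by (simp add: bit1.Rep_numeral)
  ultimately show ?thesis
    by (simp add: \<eta>_def minus_bit1_def Abs_bit1'_def Abs_bit1_inverse)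
qed

lemma eta_reverses_order: "\<eta> i < \<eta> j \<longleftrightarrow> j < i"
  by (simp add: less_bit1_def Rep_eta)

end

theory Submission
  imports Defs
begin

text \<open>
  Gaussian elimination identifies the intersection: a unipotent lower triangular matrix lies in
  the big Bruhat cell exactly when its four south-west minors do not vanish (\<open>BL_iff\<close>). Subtract \<open>a
  = L$1$0\<close> times the second column from the first, write \<open>x3, x4, x5\<close> for the reduced first column,
  \<open>y3, y4, y5\<close> for the second, \<open>f = L$3$2\<close>, \<open>i = L$4$2\<close>, \<open>j = L$4$3\<close>, and \<open>x' = (x4 - f x3, x5 - i x3)\<close>,
  \<open>y' = (y4 - f y3, y5 - i y3)\<close>. Up to sign the minors are \<open>x5 + a y5\<close>, \<open>det (x, y)\<close>, \<open>det (x', y')\<close> and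
  \<open>j x'1 - x'2\<close> (\<open>minors_Lo1\<close>). For a prescribed sign pattern the variables \<open>y3, y4, a, j\<close> occur in
  affine inequalities once the other six are fixed.

  An open set with convex fibres over its projection is contractible if the projection is
  (\<open>contractible_convex_fibres\<close>), so such variables may be forgotten. The conditions that then
  remain on \<open>y5\<close> make it select a sheet over the complex number \<open>r = x4 \<plusminus> \<i> x5\<close>.
  Equivalently \<open>r = exp z\<close> with \<open>- \<pi> < Im z < 2 \<pi>\<close>, and over a given \<open>z\<close> the values of \<open>y5\<close> form
  an interval, which can be forgotten too. What remains are triples \<open>(z, e, k)\<close> with \<open>k = x3\<close> and \<open>r
  e = - (f \<plusminus> \<i> i)\<close>, so that \<open>x'\<close> becomes \<open>r' = r (1 + k e)\<close>. This vector has to avoid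
  one half of the imaginary axis, chosen by the sign \<open>\<sigma>\<close> of the product of the first and
  the last minor, and there is a second condition depending on the sign \<open>\<tau>\<close> of the product of
  the two middle minors.

  If \<open>\<tau> = 1\<close>, then \<open>1 + k e\<close> avoids the negative half-line, so \<open>r'\<close> has the angle \<open>Im z + Im (Ln
  (1 + k e))\<close> in \<open>(- 2 \<pi>, 3 \<pi>)\<close>; the forbidden half-axis cuts this interval into windows. A
  window meeting \<open>(- \<pi>, 2 \<pi>)\<close> gives one piece, because one can forget \<open>z\<close> and let \<open>e\<close> shrink
  to \<open>0\<close>. The other windows force \<open>k \<noteq> 0\<close> and give one piece for each sign of \<open>k\<close>. This makes \<open>2
  + 4 = 6\<close> pieces for \<open>\<sigma> = 1\<close> and \<open>3\<close> for \<open>\<sigma> = -1\<close>.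

  If \<open>\<tau> = -1\<close>, the linear map carrying \<open>r\<close> to \<open>r'\<close> reverses orientation, and the admissible \<open>(e,
  k)\<close> wind around a circle on which \<open>1 + k e\<close> turns twice. Hence \<open>1 + k e\<close> has a continuous square
  root up to positive factors (\<open>half_dir\<close>), and the half-axis removes two antipodal directions of
  this root. This gives \<open>2\<close> pieces, each contractible after forgetting \<open>k\<close>.

  Each pair \<open>(\<tau>, \<sigma>)\<close> occurs for four of the sixteen sign patterns, and \<open>4 (6 + 3 + 2 +
  2) = 52\<close>.
\<close>

section \<open>Contractible pieces and convex fibres\<close>

text \<open>
  Each point \<open>y\<close> is a constant section over the open set of all \<open>x\<close> with \<open>(x, y) \<in> S\<close>; a partition of
  unity averages these constant sections, and convexity keeps the average inside \<open>S\<close>.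
\<close>
lemma continuous_section_convex_fibres:
  fixes S :: "('a::euclidean_space \<times> 'b::real_normed_vector) set"
  assumes "open S" and conv: "\<And>x. convex {y. (x, y) \<in> S}"
  obtains s where "continuous_on (fst ` S) s" "\<And>x. x \<in> fst ` S \<Longrightarrow> (x, s x) \<in> S"
proof -
  define T where "T = fst ` S"
  define U where "U = (\<lambda>y. {x. (x, y) \<in> S})"
  have opU: "open (U y)" for y
  proof -
    have "U y = (\<lambda>x. (x, y)) -` S" by (auto simp: U_def)
    then show ?thesis
      using open_vimage[OF \<open>open S\<close>, of "\<lambda>x. (x, y)"] by (simp add: continuous_intros)
  qed
  have "T \<subseteq> \<Union>(range U)" by (auto simp: T_def U_def)
  obtain \<C> where C: "T \<subseteq> \<Union>\<C>" "\<And>V. V \<in> \<C> \<Longrightarrow> open V \<and> (\<exists>W. W \<in> range U \<and> V \<subseteq> W)"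
      "\<And>x. x \<in> T \<Longrightarrow> \<exists>V. open V \<and> x \<in> V \<and> finite {W \<in> \<C>. W \<inter> V \<noteq> {}}"
  proof (rule paracompact)
    show "T \<subseteq> \<Union>(range U)" by fact
    show "open V" if "V \<in> range U" for V using that opU by auto
    fix \<C> assume "T \<subseteq> \<Union>\<C>" "\<And>V. V \<in> \<C> \<Longrightarrow> open V \<and> (\<exists>W. W \<in> range U \<and> V \<subseteq> W)"
      "\<And>x. x \<in> T \<Longrightarrow> \<exists>V. open V \<and> x \<in> V \<and> finite {W \<in> \<C>. W \<inter> V \<noteq> {}}"
    then show thesis by (rule that)
  qed
  obtain F :: "'a set \<Rightarrow> 'a \<Rightarrow> real" where
    F: "\<And>W. W \<in> \<C> \<Longrightarrow> continuous_on T (F W) \<and> (\<forall>x \<in> T. 0 \<le> F W x)"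
      "\<And>x W. \<lbrakk>W \<in> \<C>; x \<in> T; x \<notin> W\<rbrakk> \<Longrightarrow> F W x = 0"
      "\<And>x. x \<in> T \<Longrightarrow> supp_sum (\<lambda>W. F W x) \<C> = 1"
      "\<And>x. x \<in> T \<Longrightarrow> \<exists>V. open V \<and> x \<in> V \<and> finite {W \<in> \<C>. \<exists>x\<in>V. F W x \<noteq> 0}"
    by (rule subordinate_partition_of_unity[OF C(1)]) (use C(2,3) in blast)+
  have "\<forall>W\<in>\<C>. \<exists>y. W \<subseteq> U y" using C(2) by blast
  then obtain y where y: "\<And>W. W \<in> \<C> \<Longrightarrow> W \<subseteq> U (y W)" by metis
  define s where "s = (\<lambda>x. supp_sum (\<lambda>W. F W x *\<^sub>R y W) \<C>)"
  have inS: "(x, s x) \<in> S" if x: "x \<in> T" for x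
  proof -
    have "s x \<in> {y. (x, y) \<in> S}"
      unfolding s_def
    proof (rule convex_supp_sum[OF conv F(3)[OF x]])
      fix W assume W: "W \<in> \<C>"
      show "0 \<le> F W x \<and> (F W x = 0 \<or> y W \<in> {y. (x, y) \<in> S})"
        using F(1)[OF W] F(2)[OF W x] y[OF W] x by (auto simp: U_def)
    qed
    then show ?thesis by simp
  qed
  have "continuous_on T s"
  proof (clarsimp simp: continuous_on_eq_continuous_within)
    fix x assume x: "x \<in> T"
    obtain V where V: "open V" "x \<in> V" "finite {W \<in> \<C>. \<exists>x\<in>V. F W x \<noteq> 0}" using F(4)[OF x] by blast
    define \<D> where "\<D> = {W \<in> \<C>. \<exists>x\<in>V. F W x \<noteq> 0}"
    have eq: "s x' = (\<Sum>W\<in>\<D>. F W x' *\<^sub>R y W)" if "x' \<in> V" for x'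
      unfolding s_def supp_sum_def
      using V(3) that by (intro sum.mono_neutral_left) (auto simp: \<D>_def support_on_def)
    have c: "continuous (at x within T) (\<lambda>x'. \<Sum>W\<in>\<D>. F W x' *\<^sub>R y W)"
      using F(1) x by (intro continuous_intros) (auto simp: \<D>_def continuous_on_eq_continuous_within)
    have "eventually (\<lambda>x'. x' \<in> V) (at x within T)"
      using V(1,2) eventually_at_topological by blast
    then have "eventually (\<lambda>x'. s x' = (\<Sum>W\<in>\<D>. F W x' *\<^sub>R y W)) (at x within T)"
      by eventually_elim (rule eq)
    with c show "continuous (at x within T) s"
      unfolding continuous_within eq[OF V(2)] by (simp add: tendsto_cong)
  qed
  with inS show ?thesis by (auto simp: T_def intro: that)
qed

text \<open>
  Straight lines inside the fibres deform \<open>S\<close> onto the image of a continuous section.  This is the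
  only device by which coordinates are eliminated below.
\<close>
lemma contractible_convex_fibres:
  fixes S :: "('a::euclidean_space \<times> 'b::real_normed_vector) set"
  assumes "open S" and conv: "\<And>x. convex {y. (x, y) \<in> S}" and T: "contractible (fst ` S)"
  shows "contractible S"
proof -
  obtain s where s: "continuous_on (fst ` S) s" "\<And>x. x \<in> fst ` S \<Longrightarrow> (x, s x) \<in> S"
    using continuous_section_convex_fibres[OF assms(1,2)] by blast
  let ?g = "\<lambda>x. (x, s x)"
  have g: "continuous_on (fst ` S) ?g" using s(1) by (intro continuous_intros)
  have "homotopic_with (\<lambda>x. True) (top_of_set S) (top_of_set S) (?g \<circ> fst) id"
  proof (rule homotopic_with_linear)
    show "continuous_on S (?g \<circ> fst)"
      by (intro continuous_on_compose g continuous_intros)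
    show "continuous_on S id" by (rule continuous_on_id')
    fix p assume p: "p \<in> S"
    obtain x y where xy: "p = (x, y)" by (cases p)
    have "s x \<in> {y. (x, y) \<in> S}" "y \<in> {y. (x, y) \<in> S}"
      using s(2)[of x] p xy by force+
    then have "closed_segment (s x) y \<subseteq> {y. (x, y) \<in> S}"
      by (rule closed_segment_subset[OF _ _ conv])
    then show "closed_segment ((?g \<circ> fst) p) (id p) \<subseteq> S"
      by (force simp: xy dest: closed_segment_PairD)
  qed
  then show ?thesis
    using homotopy_dominated_contractibility[of "top_of_set (fst ` S)" "top_of_set S" ?g fst] g s(2) T
    by (simp add: continuous_map_subtopology_eu image_subset_iff continuous_intros)
qed

lemma components_eq_open_partition:
  fixes G :: "'i \<Rightarrow> 'a::topological_space set"
  assumes U: "(\<Union>i\<in>I. G i) = X"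
    and op: "\<And>i. i \<in> I \<Longrightarrow> openin (top_of_set X) (G i)"
    and conn: "\<And>i. i \<in> I \<Longrightarrow> connected (G i)"
    and ne: "\<And>i. i \<in> I \<Longrightarrow> G i \<noteq> {}"
    and disj: "disjoint_family_on G I"
  shows "components X = G ` I" and "inj_on G I"
proof -
  have sub: "G i \<subseteq> X" if "i \<in> I" for i
    using U that by blast
  have cl: "connected_component_set X x = G i" if i: "i \<in> I" and x: "x \<in> G i" for i x
  proof
    show "G i \<subseteq> connected_component_set X x"
      using conn[OF i] x sub[OF i] by (intro connected_component_maximal) auto
    have "X - G i = (\<Union>j\<in>I-{i}. G j)"
      using U disj i by (fastforce simp: disjoint_family_on_def)
    then have "openin (top_of_set X) (X - G i)"
      using op by (auto intro: openin_Union)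
    then have "closedin (top_of_set X) (G i)"
      using sub[OF i] by (simp add: closedin_def)
    let ?C = "connected_component_set X x"
    have CX: "?C \<subseteq> X" by (rule connected_component_subset)
    have "openin (top_of_set ?C) (?C \<inter> G i)" "closedin (top_of_set ?C) (?C \<inter> G i)"
      using op[OF i] \<open>closedin (top_of_set X) (G i)\<close> CX sub[OF i]
      by (simp_all add: openin_subtopology_Int_subset[of X] closedin_subtopology_Int_subset[of _ X] inf_absorb2)
    then have "?C \<inter> G i = {} \<or> ?C \<inter> G i = ?C"
      using connected_connected_component[of X x] by (simp add: connected_clopen)
    moreover have "x \<in> ?C" using x sub[OF i] by auto
    ultimately show "?C \<subseteq> G i" using x by blast
  qed
  show "inj_on G I"
    using disj ne by (fastforce simp: inj_on_def disjoint_family_on_def)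
  show "components X = G ` I"
  proof
    show "components X \<subseteq> G ` I"
      using U cl by (force simp: components_def)
    show "G ` I \<subseteq> components X"
      using U cl ne by (force simp: components_def)
  qed
qed

text \<open>
  Working with an explicit partition into open contractible sets, rather than with components,
  makes the count additive over disjoint open unions.
\<close>
definition contractible_pieces :: "'a::topological_space set \<Rightarrow> nat \<Rightarrow> bool" where
  "contractible_pieces X n \<longleftrightarrow> (\<exists>F. finite F \<and> card F = n \<and> disjoint F \<and> \<Union>F = X \<and>
     (\<forall>C\<in>F. C \<noteq> {} \<and> contractible C \<and> openin (top_of_set X) C))"

lemma contractible_pieces_1:
  assumes "contractible X" "X \<noteq> {}"
  shows "contractible_pieces X 1"
  unfolding contractible_pieces_def
  using assms by (intro exI[of _ "{X}"]) auto

lemma contractible_pieces_Un: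
  assumes X: "contractible_pieces X m" and Y: "contractible_pieces Y n"
    and oX: "openin (top_of_set (X \<union> Y)) X" and oY: "openin (top_of_set (X \<union> Y)) Y" and dj: "X \<inter> Y = {}"
  shows "contractible_pieces (X \<union> Y) (m + n)"
proof -
  obtain F where F: "finite F" "card F = m" "disjoint F" "\<Union>F = X"
     "\<And>C. C \<in> F \<Longrightarrow> C \<noteq> {} \<and> contractible C \<and> openin (top_of_set X) C"
    using X by (auto simp: contractible_pieces_def)
  obtain G where G: "finite G" "card G = n" "disjoint G" "\<Union>G = Y"
     "\<And>C. C \<in> G \<Longrightarrow> C \<noteq> {} \<and> contractible C \<and> openin (top_of_set Y) C"
    using Y by (auto simp: contractible_pieces_def)
  have "F \<inter> G = {}"
    using F(4,5) G(4,5) dj by blast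
  then have "card (F \<union> G) = m + n" using F G by (simp add: card_Un_disjoint)
  moreover have "disjoint (F \<union> G)"
    using F(3,4) G(3,4) dj by (intro disjoint_union) auto
  moreover have "openin (top_of_set (X \<union> Y)) C" if "C \<in> F \<union> G" for C
    using that F(5)[of C] G(5)[of C] openin_trans oX oY by blast
  ultimately show ?thesis
    unfolding contractible_pieces_def using F G by (intro exI[of _ "F \<union> G"]) auto
qed

lemma contractible_pieces_Un_open:
  assumes "contractible_pieces X m" "contractible_pieces Y n" "open X" "open Y" "X \<inter> Y = {}"
  shows "contractible_pieces (X \<union> Y) (m + n)"
  using assms by (intro contractible_pieces_Un) (auto intro: open_subset)

lemma contractible_pieces_UN:
  assumes "finite I" and "\<And>i. i \<in> I \<Longrightarrow> contractible_pieces (X i) (n i)"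
    and "\<And>i. i \<in> I \<Longrightarrow> openin (top_of_set (\<Union>i\<in>I. X i)) (X i)" and "disjoint_family_on X I"
  shows "contractible_pieces (\<Union>i\<in>I. X i) (\<Sum>i\<in>I. n i)"
  using assms
proof (induction I rule: finite_induct)
  case empty
  then show ?case by (auto simp: contractible_pieces_def intro!: exI[of _ "{}"])
next
  case (insert i I)
  let ?Y = "\<Union>i\<in>I. X i"
  have op: "openin (top_of_set (X i \<union> ?Y)) (X j)" if "j \<in> insert i I" for j
    using insert.prems(2)[OF that] by simp
  have opY: "openin (top_of_set ?Y) (X j)" if "j \<in> I" for j
    by (rule openin_subset_trans[OF op]) (use that in auto)
  have "contractible_pieces ?Y (\<Sum>i\<in>I. n i)"
    using insert.prems(1,3) opY by (intro insert.IH) (auto simp: disjoint_family_on_def)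
  moreover have "X i \<inter> ?Y = {}"
    using insert.prems(3) insert.hyps by (auto simp: disjoint_family_on_def)
  moreover have "openin (top_of_set (X i \<union> ?Y)) ?Y"
    using op by (intro openin_Union) auto
  ultimately have "contractible_pieces (X i \<union> ?Y) (n i + (\<Sum>i\<in>I. n i))"
    using insert.prems(1) op by (intro contractible_pieces_Un) auto
  then show ?case using insert.hyps by simp
qed

lemma contractible_pieces_components:
  fixes X :: "'a::real_normed_vector set"
  assumes "contractible_pieces X n"
  shows "card (components X) = n \<and> (\<forall>C\<in>components X. contractible C)"
proof -
  obtain F where F: "finite F" "card F = n" "disjoint F" "\<Union>F = X"
     "\<And>C. C \<in> F \<Longrightarrow> C \<noteq> {} \<and> contractible C \<and> openin (top_of_set X) C"
    using assms by (auto simp: contractible_pieces_def)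
  have "components X = (\<lambda>C. C) ` F"
  proof (rule components_eq_open_partition)
    show "connected C" if "C \<in> F" for C
      using F(5)[OF that] by (simp add: contractible_imp_path_connected path_connected_imp_connected)
    show "disjoint_family_on (\<lambda>C. C) F"
      using F(3) by (auto simp: disjoint_family_on_def disjoint_def)
  qed (use F in auto)
  with F show ?thesis by auto
qed

section \<open>The open Bruhat cell through minors\<close>

lemma exhaust_5: fixes i :: 5 shows "i = 0 \<or> i = 1 \<or> i = 2 \<or> i = 3 \<or> i = 4"
proof (induct i)
  case (of_int z)
  then have "z = 0 \<or> z = 1 \<or> z = 2 \<or> z = 3 \<or> z = 4" by auto
  then show ?case by auto
qed

lemma forall_5: "(\<forall>i::5. P i) \<longleftrightarrow> P 0 \<and> P 1 \<and> P 2 \<and> P 3 \<and> P 4"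
  by (metis exhaust_5)

lemma UNIV_5: "(UNIV::5 set) = {0, 1, 2, 3, 4}"
  using exhaust_5 by auto

lemma sum_5: "sum f (UNIV::5 set) = f 0 + f 1 + f 2 + f 3 + f 4"
  unfolding UNIV_5 by (simp add: ac_simps)

lemma less_5:
  "(0::5) < 1" "(0::5) < 2" "(0::5) < 3" "(0::5) < 4" "(1::5) < 2" "(1::5) < 3" "(1::5) < 4"
  "(2::5) < 3" "(2::5) < 4" "(3::5) < 4"
  "\<not> (1::5) < 0" "\<not> (2::5) < 0" "\<not> (3::5) < 0" "\<not> (4::5) < 0" "\<not> (2::5) < 1" "\<not> (3::5) < 1" "\<not> (4::5) < 1"
  "\<not> (3::5) < 2" "\<not> (4::5) < 2" "\<not> (4::5) < 3"
  by (simp_all add: less_bit1_def bit1.Rep_0 bit1.Rep_1 bit1.Rep_numeral)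

definition minor1 :: "5 rmat \<Rightarrow> real" where "minor1 L = L$4$0"
definition minor2 :: "5 rmat \<Rightarrow> real" where "minor2 L = L$3$0 * L$4$1 - L$4$0 * L$3$1"
definition minor3 :: "5 rmat \<Rightarrow> real" where
  "minor3 L = L$2$0 * (L$3$1 * L$4$2 - L$4$1 * L$3$2) - L$3$0 * (L$2$1 * L$4$2 - L$4$1 * L$2$2)
     + L$4$0 * (L$2$1 * L$3$2 - L$3$1 * L$2$2)"
text \<open>
  Expanded along the first column, like \<open>minor3\<close>; all four are minors of the last rows and the first
  columns.
\<close>
definition minor4 :: "5 rmat \<Rightarrow> real" where
  "minor4 L = L$1$0 * (L$2$1 * (L$3$2 * L$4$3 - L$4$2 * L$3$3) - L$3$1 * (L$2$2 * L$4$3 - L$4$2 * L$2$3) + L$4$1 * (L$2$2 * L$3$3 - L$3$2 * L$2$3))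
   - L$2$0 * (L$1$1 * (L$3$2 * L$4$3 - L$4$2 * L$3$3) - L$3$1 * (L$1$2 * L$4$3 - L$4$2 * L$1$3) + L$4$1 * (L$1$2 * L$3$3 - L$3$2 * L$1$3))
   + L$3$0 * (L$1$1 * (L$2$2 * L$4$3 - L$4$2 * L$2$3) - L$2$1 * (L$1$2 * L$4$3 - L$4$2 * L$1$3) + L$4$1 * (L$1$2 * L$2$3 - L$2$2 * L$1$3))
   - L$4$0 * (L$1$1 * (L$2$2 * L$3$3 - L$3$2 * L$2$3) - L$2$1 * (L$1$2 * L$3$3 - L$3$2 * L$1$3) + L$3$1 * (L$1$2 * L$2$3 - L$2$2 * L$1$3))"

lemma Up_iff: "U \<in> Up \<longleftrightarrow> (\<forall>i j. j < i \<longrightarrow> U $ i $ j = 0) \<and> (\<forall>i. U $ i $ i \<noteq> 0)" for U :: "5 rmat"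
proof -
  have "det U = (\<Prod>i\<in>UNIV. U $ i $ i)" if "\<forall>i j. j < i \<longrightarrow> U $ i $ j = 0"
    using det_upperdiagonal[of U] that by simp
  then show ?thesis
    by (auto simp: Up_def GL_def invertible_det_nz)
qed

lemma perm_matrix_eta_mult: "(perm_matrix \<eta> ** U) $ i = U $ (4 - i)" for U :: "5 rmat"
  by (simp add: vec_eq_iff matrix_matrix_mult_def perm_matrix_def \<eta>_def if_distrib[of "\<lambda>x. x * _"] cong: if_cong)

text \<open>
  Apart from scaling, an upper triangular left factor only adds lower rows to higher ones, and an upper
  triangular right factor only adds left columns to later ones.  So the south-west minors are, up to
  sign, products of diagonal entries of the two factors.
\<close>
lemma Bruhat_minors:
  assumes "A \<in> Bruhat_cell \<eta>"
  shows "minor1 A \<noteq> 0" "minor2 A \<noteq> 0" "minor3 A \<noteq> 0" "minor4 A \<noteq> 0"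
proof -
  obtain U V where A: "A = U ** perm_matrix \<eta> ** V" and U: "U \<in> Up" and V: "V \<in> Up"
    using assms by (auto simp: Bruhat_cell_def)
  have e: "A $ i $ j = U$i$0 * V$4$j + U$i$1 * V$3$j + U$i$2 * V$2$j + U$i$3 * V$1$j + U$i$4 * V$0$j" for i j
    unfolding A matrix_mul_assoc[symmetric]
    by (subst matrix_matrix_mult_def) (simp add: sum_5 perm_matrix_eta_mult)
  have z: "U$1$0 = 0" "U$2$0 = 0" "U$3$0 = 0" "U$4$0 = 0" "U$2$1 = 0" "U$3$1 = 0" "U$4$1 = 0"
     "U$3$2 = 0" "U$4$2 = 0" "U$4$3 = 0"
     "V$1$0 = 0" "V$2$0 = 0" "V$3$0 = 0" "V$4$0 = 0" "V$2$1 = 0" "V$3$1 = 0" "V$4$1 = 0"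
     "V$3$2 = 0" "V$4$2 = 0" "V$4$3 = 0" and nz: "U$i$i \<noteq> 0" "V$i$i \<noteq> 0" for i
    using U V less_5 by (auto simp: Up_iff)
  have "minor1 A = U$4$4 * V$0$0" by (simp add: minor1_def e z)
  then show "minor1 A \<noteq> 0" using nz by simp
  have "minor2 A = - (U$4$4 * V$0$0 * (U$3$3 * V$1$1))" by (simp add: minor2_def e z algebra_simps)
  then show "minor2 A \<noteq> 0" using nz by simp
  have "minor3 A = - (U$4$4 * V$0$0 * (U$3$3 * V$1$1) * (U$2$2 * V$2$2))" by (simp add: minor3_def e z algebra_simps)
  then show "minor3 A \<noteq> 0" using nz by simp
  have "minor4 A = (U$4$4 * V$0$0 * (U$3$3 * V$1$1) * (U$2$2 * V$2$2) * (U$1$1 * V$3$3))" by (simp add: minor4_def e z algebra_simps)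
  then show "minor4 A \<noteq> 0" using nz by simp
qed

text \<open>
  Elimination from the bottom row upwards.  The rows \<open>r3, r2, r1, r0\<close> are the successive remainders and
  \<open>p1, p2, p3, p4\<close> the pivots; the \<open>k\<close>-th minor is the product of the first \<open>k\<close> pivots up to sign, so
  that no pivot vanishes.
\<close>
lemma Lo1_in_Bruhat_cell:
  assumes L: "L \<in> Lo1" and m: "minor1 L \<noteq> 0" "minor2 L \<noteq> 0" "minor3 L \<noteq> 0" "minor4 L \<noteq> 0"
  shows "L \<in> Bruhat_cell \<eta>"
proof -
  define p1 where "p1 = L$4$0"
  have p1: "p1 \<noteq> 0" using m(1) by (simp add: p1_def minor1_def)
  define c3 where "c3 = L$3$0 / p1"
  define r3 where "r3 = (\<lambda>j. L$3$j - c3 * L$4$j)"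
  define p2 where "p2 = r3 1"
  have L3: "L$3$j = c3 * L$4$j + r3 j" for j by (simp add: r3_def)
  have r30: "r3 0 = 0" using p1 by (simp add: r3_def c3_def p1_def)
  have "minor2 L = - (p1 * p2)"
    by (simp add: minor2_def L3 r30 p1_def p2_def algebra_simps)
  then have p2: "p2 \<noteq> 0" using m(2) by auto
  define c2 d2 where "c2 = L$2$0 / p1" and "d2 = (L$2$1 - c2 * L$4$1) / p2"
  define r2 where "r2 = (\<lambda>j. L$2$j - c2 * L$4$j - d2 * r3 j)"
  define p3 where "p3 = r2 2"
  have L2: "L$2$j = c2 * L$4$j + d2 * r3 j + r2 j" for j by (simp add: r2_def)
  have r20: "r2 0 = 0" using p1 by (simp add: r2_def c2_def p1_def r30)
  have r21: "r2 1 = 0" using p2 by (simp add: r2_def d2_def p2_def)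
  have "minor3 L = - (p1 * p2 * p3)"
    by (simp add: minor3_def L3 L2 r30 r20 r21 p1_def p2_def p3_def algebra_simps)
  then have p3: "p3 \<noteq> 0" using m(3) by auto
  define c1 d1 where "c1 = L$1$0 / p1" and "d1 = (L$1$1 - c1 * L$4$1) / p2"
  define e1 where "e1 = (L$1$2 - c1 * L$4$2 - d1 * r3 2) / p3"
  define r1 where "r1 = (\<lambda>j. L$1$j - c1 * L$4$j - d1 * r3 j - e1 * r2 j)"
  define p4 where "p4 = r1 3"
  have L1: "L$1$j = c1 * L$4$j + d1 * r3 j + e1 * r2 j + r1 j" for j by (simp add: r1_def)
  have r10: "r1 0 = 0" using p1 by (simp add: r1_def c1_def p1_def r30 r20)
  have r11: "r1 1 = 0" using p2 by (simp add: r1_def d1_def p2_def r21)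
  have r12: "r1 2 = 0" using p3 by (simp add: r1_def e1_def p3_def)
  have "minor4 L = p1 * p2 * p3 * p4"
    by (simp add: minor4_def L3 L2 L1 r30 r20 r21 r10 r11 r12 p1_def p2_def p3_def p4_def algebra_simps)
  then have p4: "p4 \<noteq> 0" using m(4) by auto
  define c0 d0 where "c0 = L$0$0 / p1" and "d0 = (L$0$1 - c0 * L$4$1) / p2"
  define e0 where "e0 = (L$0$2 - c0 * L$4$2 - d0 * r3 2) / p3"
  define f0 where "f0 = (L$0$3 - c0 * L$4$3 - d0 * r3 3 - e0 * r2 3) / p4"
  define r0 where "r0 = (\<lambda>j. L$0$j - c0 * L$4$j - d0 * r3 j - e0 * r2 j - f0 * r1 j)"
  have L0: "L$0$j = c0 * L$4$j + d0 * r3 j + e0 * r2 j + f0 * r1 j + r0 j" for j by (simp add: r0_def)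
  have r0z: "r0 0 = 0" "r0 1 = 0" "r0 2 = 0" "r0 3 = 0"
    using p1 p2 p3 p4
    by (simp_all add: r0_def c0_def d0_def e0_def f0_def p1_def p2_def p3_def p4_def r30 r20 r10 r21 r11 r12)
  define U :: "5 rmat" where "U = (\<chi> i j.
     if i = j then 1 else if i = 0 then (if j = 1 then f0 else if j = 2 then e0 else if j = 3 then d0 else c0)
     else if i = 1 then (if j = 2 then e1 else if j = 3 then d1 else if j = 4 then c1 else 0)
     else if i = 2 then (if j = 3 then d2 else if j = 4 then c2 else 0)
     else if i = 3 then (if j = 4 then c3 else 0) else 0)"
  define V :: "5 rmat" where "V = (\<chi> i j. if i = 0 then L$4$j else if i = 1 then r3 j
     else if i = 2 then r2 j else if i = 3 then r1 j else r0 j)"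
  have "L = U ** (perm_matrix \<eta> ** V)"
    unfolding matrix_matrix_mult_def[of U] vec_eq_iff
    by (simp add: forall_5 sum_5 perm_matrix_eta_mult U_def V_def L0 L1 L2 L3)
  then have LUV: "L = U ** perm_matrix \<eta> ** V" by (simp add: matrix_mul_assoc)
  have "U \<in> Up" by (simp add: Up_iff forall_5 less_5 U_def)
  \<comment> \<open>the last diagonal entry of \<open>V\<close> is not a pivot; it is nonzero because \<open>L\<close> is invertible\<close>
  moreover have "det L = 1"
    using L by (subst det_lowerdiagonal) (auto simp: Lo1_def)
  then have "det V \<noteq> 0" using LUV by (auto simp: det_mul)
  then have "V \<in> Up"
    by (simp add: Up_def GL_def invertible_det_nz forall_5 less_5) (simp add: V_def r30 r20 r21 r10 r11 r12 r0z)
  ultimately show ?thesis using LUV by (auto simp: Bruhat_cell_def)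
qed

lemma BL_iff: "L \<in> BL \<eta> \<longleftrightarrow> L \<in> Lo1 \<and> minor1 L \<noteq> 0 \<and> minor2 L \<noteq> 0 \<and> minor3 L \<noteq> 0 \<and> minor4 L \<noteq> 0"
  using Bruhat_minors Lo1_in_Bruhat_cell by (auto simp: BL_def)

section \<open>The reduced space, reflecting case\<close>

text \<open>
  The space left after all eliminations.  The number \<open>exp z\<close> encodes the last two entries of the reduced
  first column, and \<open>exp z * (1 + k * e)\<close> encodes them after the third column has been used to reduce
  them further.  The excluded values are exactly those for which an eliminated coordinate has no
  admissible value.
\<close>
definition reduced :: "real \<Rightarrow> real \<Rightarrow> ((complex \<times> complex) \<times> real) set" where
  "reduced \<tau> \<sigma> = {((z, e), k). - pi < Im z \<and> Im z < 2 * pi \<and> \<not> (Im e = 0 \<and> \<tau> * (1 + k * Re e) \<le> 0) \<and>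
     \<not> (Re (exp z * (1 + of_real k * e)) = 0 \<and> \<sigma> * Im (exp z * (1 + of_real k * e)) \<ge> 0)}"

lemma pos_mult_iff: "x > 0 \<Longrightarrow> 0 < x * y \<longleftrightarrow> 0 < y" for x y :: real
  by (simp add: zero_less_mult_iff)

text \<open>
  A square root of \<open>1 + k e\<close> up to a positive factor.  If \<open>w = m exp (2 \<i> \<phi>)\<close>, then \<open>m + w\<close> is \<open>2 m cos \<phi>\<close>
  times \<open>exp (\<i> \<phi>)\<close> and \<open>\<i> (m - w)\<close> is \<open>2 m sin \<phi>\<close> times \<open>exp (\<i> \<phi>)\<close>.  Weighting them with \<open>Im e\<close> and \<open>k\<close>
  fixes the sign of the root by \<open>Im e\<close> where \<open>Im e \<noteq> 0\<close> and by \<open>k\<close> where \<open>k \<noteq> 0\<close>; the two choices agree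
  because \<open>Im w = k Im e\<close>.
\<close>
definition half_dir :: "complex \<Rightarrow> real \<Rightarrow> complex" where
  "half_dir e k = (let w = 1 + of_real k * e; m = of_real (norm w) in
     of_real (Im e) * (m + w) + \<i> * of_real k * (m - w))"

text \<open>
  The condition that \<open>\<tau> = -1\<close> imposes on \<open>(e, k)\<close>.  It keeps \<open>1 + k e\<close> off the nonnegative half-line
  except for \<open>k = 0\<close>, where the half-plane containing \<open>e\<close> tells the two sides of that half-line apart.
\<close>
abbreviation reflecting :: "complex \<Rightarrow> real \<Rightarrow> bool" where
  "reflecting e k \<equiv> \<not> (Im e = 0 \<and> 1 + k * Re e \<ge> 0)"

lemma half_dir_square:
  assumes "reflecting e k"
  obtains b where "b > 0" "(half_dir e k)\<^sup>2 = of_real b * (1 + of_real k * e)"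
proof -
  define w where "w = 1 + of_real k * e"
  define m where "m = norm w"
  define A where "A = Im e"
  have Imw: "Im w = k * A" and Rew: "Re w = 1 + k * Re e" by (simp_all add: w_def A_def)
  have m2: "m\<^sup>2 = (Re w)\<^sup>2 + (Im w)\<^sup>2" by (simp add: m_def cmod_power2)
  have mR: "\<bar>Re w\<bar> \<le> m" by (simp add: m_def abs_Re_le_cmod)
  let ?b = "2 * (A\<^sup>2 * (m + Re w) + k\<^sup>2 * (m - Re w) + 2 * (A\<^sup>2 * k\<^sup>2))"
  have h: "half_dir e k = of_real A * (of_real m + w) + \<i> * of_real k * (of_real m - w)"
    by (simp add: half_dir_def w_def m_def A_def Let_def)
  have "(half_dir e k)\<^sup>2 = of_real ?b * w"
  proof (rule complex_eqI)
    have m2': "m * m = Re w * Re w + Im w * Im w" using m2 by (simp add: power2_eq_square)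
    show "Re ((half_dir e k)\<^sup>2) = Re (of_real ?b * w)"
      using m2' Imw by (simp add: h power2_eq_square) algebra
    show "Im ((half_dir e k)\<^sup>2) = Im (of_real ?b * w)"
      using m2' Imw by (simp add: h power2_eq_square) algebra
  qed
  moreover have "?b > 0"
  proof (cases "A = 0")
    case True
    then have "Re w < 0" using assms by (auto simp: A_def Rew)
    moreover from this have "k \<noteq> 0" using Rew by auto
    ultimately show ?thesis using True mR by (auto intro!: mult_pos_pos)
  next
    case False
    show ?thesis
    proof (cases "k = 0")
      case True
      then show ?thesis using False by (simp add: Rew m_def w_def)
    next
      case k: False
      have "A\<^sup>2 * (m + Re w) \<ge> 0" "k\<^sup>2 * (m - Re w) \<ge> 0" using mR by auto
      moreover have "A\<^sup>2 * k\<^sup>2 > 0" using False k by simp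
      ultimately have "A\<^sup>2 * (m + Re w) + k\<^sup>2 * (m - Re w) + 2 * (A\<^sup>2 * k\<^sup>2) > 0"
        by (intro add_nonneg_pos add_nonneg_nonneg) auto
      then show ?thesis by simp
    qed
  qed
  ultimately show ?thesis using that unfolding w_def by blast
qed

lemma half_dir_real_iff:
  assumes "reflecting e k" "\<omega> \<noteq> 0"
  shows "Im (half_dir e k * \<omega>) = 0 \<longleftrightarrow> Im (\<omega>\<^sup>2 * (1 + of_real k * e)) = 0 \<and> Re (\<omega>\<^sup>2 * (1 + of_real k * e)) \<ge> 0"
proof -
  obtain b where b: "b > 0" "(half_dir e k)\<^sup>2 = of_real b * (1 + of_real k * e)"
    using half_dir_square[OF assms(1)] .
  let ?X = "half_dir e k * \<omega>"
  have X: "?X\<^sup>2 = of_real b * (\<omega>\<^sup>2 * (1 + of_real k * e))" by (simp add: power_mult_distrib b(2) mult_ac)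
  have "Im ?X = 0 \<longleftrightarrow> Im (?X\<^sup>2) = 0 \<and> Re (?X\<^sup>2) \<ge> 0"
  proof -
    have "Im (?X\<^sup>2) = 2 * Re ?X * Im ?X" "Re (?X\<^sup>2) = (Re ?X)\<^sup>2 - (Im ?X)\<^sup>2"
      by (simp_all only: Re_power2 Im_power2)
    then show ?thesis by (auto simp del: times_complex.sel)
  qed
  then show ?thesis unfolding X using b(1) by (simp add: zero_le_mult_iff)
qed

text \<open>
  For \<open>Im e \<noteq> 0\<close> the direction of the root is that of \<open>x + \<i> k Im e\<close> or its negative, which makes the sign
  of the imaginary part explicit.
\<close>
lemma Im_half_dir:
  assumes "reflecting e k"
  defines "x \<equiv> norm (1 + of_real k * e) + 1 + k * Re e"
  shows "Im e \<noteq> 0 \<Longrightarrow> x > 0"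
    and "Im (half_dir e k * \<omega>) > 0 \<longleftrightarrow>
      (if Im e = 0 then k * Re \<omega> > 0 else Im e * (Im \<omega> * x + Re \<omega> * k * Im e) > 0)"
proof -
  define m where "m = norm (1 + of_real k * e)"
  define A B where "A = Im e" and "B = Re e"
  have m2: "m\<^sup>2 = (1 + k * B)\<^sup>2 + (k * A)\<^sup>2" by (simp add: m_def cmod_power2 A_def B_def)
  have mR: "\<bar>1 + k * B\<bar> \<le> m" using abs_Re_le_cmod[of "1 + of_real k * e"] by (simp add: m_def B_def)
  have xm: "x = m + 1 + k * B" by (simp add: x_def m_def B_def)
  have im: "Im (half_dir e k * \<omega>) = Im \<omega> * A * (x + k\<^sup>2) + Re \<omega> * k * (A\<^sup>2 + m - 1 - k * B)"
    unfolding half_dir_def Let_def xm m_def[symmetric]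
    by (simp add: A_def[symmetric] B_def[symmetric] power2_eq_square algebra_simps)
  have pos: "x > 0" if "A \<noteq> 0"
  proof (cases "k = 0")
    case True then show ?thesis by (simp add: xm m_def)
  next
    case False
    then have "(k * A)\<^sup>2 > 0" using that by simp
    then have "\<bar>1 + k * B\<bar>\<^sup>2 < m\<^sup>2" using m2 by (simp add: power2_abs)
    then have "\<bar>1 + k * B\<bar> < m" using mR by (smt (verit) power_mono abs_ge_zero)
    then show ?thesis by (simp add: xm)
  qed
  then show "Im e \<noteq> 0 \<Longrightarrow> x > 0" by (simp add: A_def)
  show "Im (half_dir e k * \<omega>) > 0 \<longleftrightarrow>
      (if Im e = 0 then k * Re \<omega> > 0 else Im e * (Im \<omega> * x + Re \<omega> * k * Im e) > 0)"
  proof (cases "A = 0")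
    case True
    then have neg: "1 + k * B < 0" using assms(1) by (auto simp: A_def B_def)
    then have m: "m = - (1 + k * B)" using m2 True mR by (simp add: power2_eq_iff)
    then have "Im (half_dir e k * \<omega>) = (k * Re \<omega>) * (2 * - (1 + k * B))"
      unfolding im m True by (simp add: algebra_simps)
    moreover have "2 * - (1 + k * B) > 0" using neg by (intro mult_pos_pos) auto
    ultimately show ?thesis using True pos_mult_iff[of "2 * - (1 + k * B)" "k * Re \<omega>"]
      by (simp only: A_def mult.commute[of "k * Re \<omega>"] if_True simp_thms)
  next
    case False
    have "(m - 1 - k * B) * x = (k * A)\<^sup>2" using m2 by (simp add: xm power2_eq_square algebra_simps)
    then have "x * Im (half_dir e k * \<omega>) = (x + k\<^sup>2) * (A * (Im \<omega> * x + Re \<omega> * k * A))"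
      unfolding im by (simp add: power2_eq_square) algebra
    moreover have "x > 0" "x + k\<^sup>2 > 0" using pos[OF False] by (auto simp: add_pos_nonneg)
    ultimately have "Im (half_dir e k * \<omega>) > 0 \<longleftrightarrow> A * (Im \<omega> * x + Re \<omega> * k * A) > 0"
      by (metis zero_less_mult_pos mult_pos_pos)
    then show ?thesis using False by (simp add: A_def)
  qed
qed

text \<open>
  For \<open>Im e \<noteq> 0\<close> the slope of the root is proportional to \<open>k / x\<close>, which increases with \<open>k\<close> by the
  triangle inequality.  A linear condition on the slope therefore cuts out an interval of \<open>k\<close>.
\<close>
lemma convex_half_dir_fibre:
  "convex {k. reflecting e k \<and> Im (half_dir e k * \<omega>) > 0}" (is "convex ?S")
proof -
  define x where "x = (\<lambda>k. norm (1 + of_real k * e) + 1 + k * Re e)"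
  have "b \<in> ?S" if S: "a \<in> ?S" "c \<in> ?S" and le: "a \<le> b" "b \<le> c" for a b c
  proof (cases "Im e = 0")
    case True
    have V: "1 + a * Re e < 0" "1 + c * Re e < 0" and pa: "a * Re \<omega> > 0" "c * Re \<omega> > 0"
      using S Im_half_dir(2)[of e a \<omega>] Im_half_dir(2)[of e c \<omega>] True by auto
    have "1 + b * Re e < 0"
      using V le by (smt (verit) mult_right_mono mult_right_mono_neg)
    moreover have "b * Re \<omega> > 0"
      using pa le by (smt (verit) mult_right_mono mult_right_mono_neg)
    ultimately show ?thesis using Im_half_dir(2)[of e b \<omega>] True by auto
  next
    case False
    have pos: "x k > 0" for k
      using Im_half_dir(1)[of e k] False by (simp add: x_def)
    have mono: "k * x k' \<le> k' * x k" if "k \<le> k'" for k k'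
    proof -
      let ?m = "\<lambda>k. norm (1 + of_real k * e)"
      have A: "norm (of_real k * (1 + of_real k' * e)) = \<bar>k\<bar> * ?m k'"
         and B: "norm (of_real k' * (1 + of_real k * e)) = \<bar>k'\<bar> * ?m k" for k k'
        by (simp_all only: norm_mult norm_of_real)
      have "\<bar>\<bar>k\<bar> * ?m k' - \<bar>k'\<bar> * ?m k\<bar> \<le> norm (of_real k * (1 + of_real k' * e) - of_real k' * (1 + of_real k * e))"
        unfolding A[symmetric] B[symmetric] by (rule norm_triangle_ineq3)
      also have "of_real k * (1 + of_real k' * e) - of_real k' * (1 + of_real k * e) = complex_of_real (k - k')"
        by (simp add: algebra_simps)
      also have "norm \<dots> = k' - k" using that by (simp only: norm_of_real)
      finally have tri: "\<bar>\<bar>k\<bar> * ?m k' - \<bar>k'\<bar> * ?m k\<bar> \<le> k' - k" .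
      have "k * ?m k' - k' * ?m k \<le> k' - k"
      proof -
        consider "k \<ge> 0" | "k' \<le> 0" | "k < 0" "k' > 0" by linarith
        then show ?thesis
        proof cases
          case 3
          then have "k * ?m k' \<le> 0" "k' * ?m k \<ge> 0" by (simp_all add: mult_nonpos_nonneg)
          then show ?thesis using that by linarith
        qed (use tri that in auto)
      qed
      then show ?thesis by (simp add: x_def algebra_simps)
    qed
    define s where "s = (\<lambda>k. k / x k)"
    have s: "s a \<le> s b" "s b \<le> s c"
      using mono[OF le(1)] mono[OF le(2)] pos by (simp_all add: s_def field_simps)
    have iff: "k \<in> ?S \<longleftrightarrow> Im e * (Im \<omega> + Re \<omega> * Im e * s k) > 0" for k
    proof -
      have "Im e * (Im \<omega> * x k + Re \<omega> * k * Im e) = x k * (Im e * (Im \<omega> + Re \<omega> * Im e * s k))"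
        using pos[of k] by (simp add: s_def field_simps)
      moreover have "k \<in> ?S \<longleftrightarrow> 0 < Im e * (Im \<omega> * x k + Re \<omega> * k * Im e)"
        using Im_half_dir(2)[of e k \<omega>] False by (simp add: x_def del: times_complex.sel)
      ultimately show ?thesis by (simp only: pos_mult_iff[OF pos[of k]])
    qed
    have "Im e * (Im \<omega> + Re \<omega> * Im e * s b) \<ge> min (Im e * (Im \<omega> + Re \<omega> * Im e * s a)) (Im e * (Im \<omega> + Re \<omega> * Im e * s c))"
    proof (cases "Im e * (Re \<omega> * Im e) \<ge> 0")
      case True
      then have "Im e * (Re \<omega> * Im e) * s a \<le> Im e * (Re \<omega> * Im e) * s b" using s by (intro mult_left_mono)
      then show ?thesis by (simp add: algebra_simps)
    next
      case False
      then have "Im e * (Re \<omega> * Im e) * s c \<le> Im e * (Re \<omega> * Im e) * s b" using s by (intro mult_left_mono_neg) auto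
      then show ?thesis by (simp add: algebra_simps)
    qed
    then show ?thesis using S iff by (smt (verit))
  qed
  then have "is_interval ?S" unfolding is_interval_1 by blast
  then show ?thesis by (simp only: is_interval_convex_1)
qed

text \<open>
  As a condition on the direction of \<open>e * \<omega>\<close> this is a sector symmetric about the negative real axis:
  it omits the closed cone around the positive real axis that is spanned by \<open>\<omega>\<close> and its conjugate,
  taken with the sign that puts it into the right half-plane (the closed right half-plane itself if
  \<open>Re \<omega> = 0\<close>).
\<close>
definition reflecting_sector :: "complex \<Rightarrow> complex set" where
  "reflecting_sector \<omega> = {e. Re (e * \<omega>) < 0 \<or> \<bar>Re \<omega>\<bar> * \<bar>Im (e * \<omega>)\<bar> > \<bar>Im \<omega>\<bar> * Re (e * \<omega>)}"

text \<open>
  As \<open>k\<close> tends to infinity in either direction, the norm behaves like \<open>\<bar>k\<bar> * norm e\<close>.  For \<open>q < 0\<close> this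
  turns solvability into \<open>- q * norm e < \<bar>I\<bar>\<close> with \<open>I = Re e * q + Im e * p\<close>, and squaring gives the sector
  condition; for \<open>q \<ge> 0\<close> both sides hold.
\<close>
lemma reflecting_sector_upper:
  assumes A: "Im e > 0" and nz: "p \<noteq> 0 \<or> q \<noteq> 0"
  shows "(\<exists>k. q * (norm (1 + of_real k * e) + 1 + k * Re e) + p * k * Im e > 0) \<longleftrightarrow>
    Re e * p - Im e * q < 0 \<or> \<bar>p\<bar> * \<bar>Re e * q + Im e * p\<bar> > \<bar>q\<bar> * (Re e * p - Im e * q)"
    (is "(\<exists>k. ?F k > 0) \<longleftrightarrow> ?R")
proof -
  define A B where "A = Im e" and "B = Re e"
  define I R where "I = B * q + A * p" and "R = B * p - A * q"
  define n where "n = norm e"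
  have "A > 0" using assms by (simp add: A_def)
  have "p\<^sup>2 + q\<^sup>2 > 0" using nz by (auto simp: sum_power2_gt_zero_iff)
  then have "A * (p\<^sup>2 + q\<^sup>2) > 0" using \<open>A > 0\<close> by simp
  moreover have "p * I - q * R = A * (p\<^sup>2 + q\<^sup>2)"
    by (simp add: I_def R_def power2_eq_square algebra_simps)
  moreover have "p * I \<le> \<bar>p\<bar> * \<bar>I\<bar>" by (metis abs_ge_self abs_mult)
  ultimately have key: "q * R < \<bar>p\<bar> * \<bar>I\<bar>" by linarith
  have R: "?R \<longleftrightarrow> R < 0 \<or> \<bar>p\<bar> * \<bar>I\<bar> > \<bar>q\<bar> * R"
    by (simp add: A_def B_def I_def R_def)
  show ?thesis
  proof (cases "q \<ge> 0")
    case True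
    have "\<exists>k. ?F k > 0"
    proof (cases "q = 0")
      case q: True
      then have "p * p * A > 0" using nz \<open>A > 0\<close> by (auto simp: zero_less_mult_iff)
      then show ?thesis using q by (intro exI[of _ p]) (simp add: A_def)
    next
      case False
      then show ?thesis using True by (intro exI[of _ 0]) auto
    qed
    moreover have ?R using key True R by auto
    ultimately show ?thesis by blast
  next
    case False
    then have q: "q < 0" by simp
    have "R < 0 \<or> \<bar>p\<bar> * \<bar>I\<bar> > \<bar>q\<bar> * R \<longleftrightarrow> \<bar>q\<bar> * \<bar>R\<bar> < \<bar>p\<bar> * \<bar>I\<bar>"
      using key q by (cases "R < 0") auto
    also have "\<dots> \<longleftrightarrow> (\<bar>q\<bar> * \<bar>R\<bar>)\<^sup>2 < (\<bar>p\<bar> * \<bar>I\<bar>)\<^sup>2"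
      by (meson abs_ge_zero mult_nonneg_nonneg power2_less_imp_less power_strict_mono zero_less_numeral)
    also have "\<dots> \<longleftrightarrow> q\<^sup>2 * R\<^sup>2 < p\<^sup>2 * I\<^sup>2" by (simp add: power_mult_distrib)
    also have "\<dots> \<longleftrightarrow> 0 < (p\<^sup>2 + q\<^sup>2) * (I\<^sup>2 - q\<^sup>2 * n\<^sup>2)"
    proof -
      have "n\<^sup>2 = A\<^sup>2 + B\<^sup>2" by (simp add: n_def cmod_power2 A_def B_def)
      then have "(p\<^sup>2 + q\<^sup>2) * (I\<^sup>2 - q\<^sup>2 * n\<^sup>2) = p\<^sup>2 * I\<^sup>2 - q\<^sup>2 * R\<^sup>2"
        by (simp add: I_def R_def power2_eq_square algebra_simps)
      then show ?thesis by simp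
    qed
    also have "\<dots> \<longleftrightarrow> (- q * n)\<^sup>2 < \<bar>I\<bar>\<^sup>2"
      using pos_mult_iff[OF \<open>p\<^sup>2 + q\<^sup>2 > 0\<close>] by (simp add: power_mult_distrib)
    also have "\<dots> \<longleftrightarrow> - q * n < \<bar>I\<bar>"
    proof -
      have "- q * n \<ge> 0" using q by (simp add: n_def mult_nonpos_nonneg)
      then show ?thesis
        by (meson abs_ge_zero power2_less_imp_less power_strict_mono zero_less_numeral)
    qed
    finally have R': "?R \<longleftrightarrow> - q * n < \<bar>I\<bar>" using R by simp
    have F: "?F k = q * (norm (1 + of_real k * e) + 1) + k * I" for k
      by (simp add: I_def A_def B_def algebra_simps)
    show ?thesis
    proof
      assume "\<exists>k. ?F k > 0"
      then obtain k where k: "?F k > 0" by blast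
      have "\<bar>k\<bar> * n = norm ((1 + of_real k * e) - 1)" by (simp add: n_def norm_mult)
      also have "\<dots> \<le> norm (1 + of_real k * e) + 1" using norm_triangle_ineq4 by (metis norm_one)
      finally have "q * (norm (1 + of_real k * e) + 1) \<le> q * (\<bar>k\<bar> * n)" using q by (simp add: mult_left_mono_neg)
      moreover have "k * I \<le> \<bar>k\<bar> * \<bar>I\<bar>" by (metis abs_ge_self abs_mult)
      ultimately have "0 < q * (\<bar>k\<bar> * n) + \<bar>k\<bar> * \<bar>I\<bar>" using k F[of k] by linarith
      also have "\<dots> = \<bar>k\<bar> * (q * n + \<bar>I\<bar>)" by (simp add: algebra_simps)
      finally have "0 < q * n + \<bar>I\<bar>" by (simp add: zero_less_mult_iff)
      then show ?R using R' by simp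
    next
      assume ?R
      then have d: "\<bar>I\<bar> + q * n > 0" using R' by simp
      \<comment> \<open>large enough for the lower bound \<open>2 q + t (\<bar>I\<bar> + q n)\<close> of the expression to equal \<open>1\<close>\<close>
      define t where "t = (1 - 2 * q) / (\<bar>I\<bar> + q * n)"
      have t: "t > 0" "t * (\<bar>I\<bar> + q * n) = 1 - 2 * q" using d q by (auto simp: t_def)
      define k where "k = (if I \<ge> 0 then t else - t)"
      have kI: "k * I = t * \<bar>I\<bar>" and ak: "\<bar>k\<bar> = t" using t by (auto simp: k_def)
      have "norm (1 + of_real k * e) \<le> 1 + t * n"
        using norm_triangle_ineq[of 1 "of_real k * e"] by (simp add: norm_mult n_def ak)
      then have "q * (norm (1 + of_real k * e) + 1) \<ge> q * (2 + t * n)" using q by (simp add: mult_left_mono_neg)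
      then have "?F k \<ge> q * (2 + t * n) + t * \<bar>I\<bar>" using F[of k] kI by linarith
      also have "q * (2 + t * n) + t * \<bar>I\<bar> = 2 * q + t * (\<bar>I\<bar> + q * n)" by (simp add: algebra_simps)
      finally show "\<exists>k. ?F k > 0" using t(2) by (intro exI[of _ k]) linarith
    qed
  qed
qed

text \<open>
  The case \<open>Im e < 0\<close> is the case \<open>Im e > 0\<close> for the conjugates of \<open>e\<close> and \<open>\<omega>\<close>.
\<close>
lemma reflecting_sector_iff:
  assumes "\<omega> \<noteq> 0"
  shows "(\<exists>k. reflecting e k \<and> Im (half_dir e k * \<omega>) > 0) \<longleftrightarrow> e \<in> reflecting_sector \<omega>"
proof -
  have nz: "Re \<omega> \<noteq> 0 \<or> Im \<omega> \<noteq> 0" using assms by (auto simp: complex_eq_iff)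
  consider "Im e > 0" | "Im e < 0" | "Im e = 0" by linarith
  then show ?thesis
  proof cases
    case 1
    then have "(\<exists>k. reflecting e k \<and> Im (half_dir e k * \<omega>) > 0) \<longleftrightarrow>
       (\<exists>k. Im \<omega> * (norm (1 + of_real k * e) + 1 + k * Re e) + Re \<omega> * k * Im e > 0)"
      using Im_half_dir(2)[of e _ \<omega>] pos_mult_iff[of "Im e"] by auto
    also have "\<dots> \<longleftrightarrow> e \<in> reflecting_sector \<omega>"
      unfolding reflecting_sector_upper[OF 1 nz] by (simp add: reflecting_sector_def)
    finally show ?thesis .
  next
    case 2
    have "norm (1 + of_real k * cnj e) = norm (1 + of_real k * e)" for k
      by (metis complex_cnj_add complex_cnj_complex_of_real complex_cnj_mult complex_cnj_one complex_mod_cnj)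
    then have "reflecting e k \<and> Im (half_dir e k * \<omega>) > 0 \<longleftrightarrow>
       - Im \<omega> * (norm (1 + of_real k * cnj e) + 1 + k * Re (cnj e)) + Re \<omega> * k * Im (cnj e) > 0" for k
      using Im_half_dir(2)[of e k \<omega>] 2 by (auto simp: zero_less_mult_iff)
    then have "(\<exists>k. reflecting e k \<and> Im (half_dir e k * \<omega>) > 0) \<longleftrightarrow>
       (\<exists>k. - Im \<omega> * (norm (1 + of_real k * cnj e) + 1 + k * Re (cnj e)) + Re \<omega> * k * Im (cnj e) > 0)"
      by blast
    also have "\<dots> \<longleftrightarrow> e \<in> reflecting_sector \<omega>"
    proof -
      have "\<bar>Re (cnj e) * - Im \<omega> + Im (cnj e) * Re \<omega>\<bar> = \<bar>Im (e * \<omega>)\<bar>"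
        "Re (cnj e) * Re \<omega> - Im (cnj e) * - Im \<omega> = Re (e * \<omega>)"
        by auto
      then show ?thesis
        using reflecting_sector_upper[of "cnj e" "Re \<omega>" "- Im \<omega>"] 2 nz unfolding reflecting_sector_def by simp
    qed
    finally show ?thesis .
  next
    case 3
    have "(\<exists>k. reflecting e k \<and> Im (half_dir e k * \<omega>) > 0) \<longleftrightarrow> (\<exists>k. 1 + k * Re e < 0 \<and> k * Re \<omega> > 0)"
    proof -
      have "reflecting e k \<and> Im (half_dir e k * \<omega>) > 0 \<longleftrightarrow> 1 + k * Re e < 0 \<and> k * Re \<omega> > 0" for k
        using Im_half_dir(2)[of e k \<omega>] 3 by (auto simp del: times_complex.sel)
      then show ?thesis by blast
    qed
    also have "\<dots> \<longleftrightarrow> Re e * Re \<omega> < 0"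
    proof
      assume "\<exists>k. 1 + k * Re e < 0 \<and> k * Re \<omega> > 0"
      then obtain k where "1 + k * Re e < 0" "k * Re \<omega> > 0" by blast
      then have k: "k * Re e < 0" "k * Re \<omega> > 0" by linarith+
      then show "Re e * Re \<omega> < 0" by (auto simp: mult_less_0_iff zero_less_mult_iff)
    next
      assume *: "Re e * Re \<omega> < 0"
      then have "1 + (- 2 / Re e) * Re e < 0" "- 2 / Re e * Re \<omega> > 0"
        by (auto simp: mult_less_0_iff zero_less_mult_iff field_simps)
      then show "\<exists>k. 1 + k * Re e < 0 \<and> k * Re \<omega> > 0" by blast
    qed
    also have "\<dots> \<longleftrightarrow> e \<in> reflecting_sector \<omega>"
    proof -
      have "\<bar>Im \<omega>\<bar> * (Re e * Re \<omega>) < \<bar>Re \<omega>\<bar> * \<bar>Re e * Im \<omega>\<bar> \<longrightarrow> Re e * Re \<omega> < 0"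
      proof -
        have "\<bar>Re \<omega>\<bar> * \<bar>Re e * Im \<omega>\<bar> = \<bar>Im \<omega>\<bar> * \<bar>Re e * Re \<omega>\<bar>" by (simp add: abs_mult)
        then show ?thesis by (cases "Re e * Re \<omega> < 0") auto
      qed
      then show ?thesis using 3 by (auto simp: reflecting_sector_def)
    qed
    finally show ?thesis .
  qed
qed

lemma reflecting_sector_center:
  assumes "\<omega> \<noteq> 0"
  shows "- 1 / \<omega> \<in> reflecting_sector \<omega>"
proof -
  have "- 1 / \<omega> * \<omega> = - 1" using assms by simp
  then show ?thesis unfolding reflecting_sector_def mem_Collect_eq by (simp only:) simp
qed

text \<open>
  The sector is star-shaped about \<open>- 1 / \<omega>\<close>, because multiplication by \<open>\<omega>\<close> moves this point to the
  symmetry axis.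
\<close>
lemma reflecting_sector_star:
  assumes "\<omega> \<noteq> 0" "e \<in> reflecting_sector \<omega>"
  shows "closed_segment e (- 1 / \<omega>) \<subseteq> reflecting_sector \<omega>"
proof
  fix x assume "x \<in> closed_segment e (- 1 / \<omega>)"
  then obtain t where t: "0 \<le> t" "t \<le> 1" and x: "x = (1 - t) *\<^sub>R e + t *\<^sub>R (- 1 / \<omega>)"
    by (auto simp: closed_segment_def)
  let ?f = "e * \<omega>"
  have "x * \<omega> = (1 - t) *\<^sub>R ?f - of_real t"
    using assms(1) by (simp add: x scaleR_conv_of_real algebra_simps)
  then have re: "Re (x * \<omega>) = (1 - t) * Re ?f - t" and im: "Im (x * \<omega>) = (1 - t) * Im ?f"
    by (simp_all del: times_complex.sel)
  show "x \<in> reflecting_sector \<omega>"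
  proof (cases "t = 1")
    case True
    then show ?thesis using re by (simp add: reflecting_sector_def)
  next
    case False
    then have t1: "1 - t > 0" using t by simp
    from assms(2) consider "Re ?f < 0" | "\<bar>Re \<omega>\<bar> * \<bar>Im ?f\<bar> > \<bar>Im \<omega>\<bar> * Re ?f"
      by (auto simp: reflecting_sector_def simp del: times_complex.sel)
    then show ?thesis
    proof cases
      case 1
      then have "(1 - t) * Re ?f < 0" using t1 by (simp only: mult_pos_neg)
      then have "Re (x * \<omega>) < 0" using t re by linarith
      then show ?thesis by (simp add: reflecting_sector_def)
    next
      case 2
      have "\<bar>Im \<omega>\<bar> * Re (x * \<omega>) \<le> (1 - t) * (\<bar>Im \<omega>\<bar> * Re ?f)"
        unfolding re using t by (simp add: algebra_simps)
      also have "\<dots> < (1 - t) * (\<bar>Re \<omega>\<bar> * \<bar>Im ?f\<bar>)"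
        using 2 t1 by (simp only: mult_less_cancel_left_pos)
      also have "\<dots> = \<bar>Re \<omega>\<bar> * \<bar>Im (x * \<omega>)\<bar>" unfolding im using t1 by (simp add: abs_mult)
      finally show ?thesis by (simp add: reflecting_sector_def)
    qed
  qed
qed

text \<open>
  A square root of \<open>exp z\<close> divided by the unit vector of the forbidden half-axis; it is continuous in
  \<open>z\<close> because \<open>z\<close> is a logarithm.
\<close>
definition half_root :: "real \<Rightarrow> complex \<Rightarrow> complex" where
  "half_root \<sigma> z = exp ((z - \<i> * of_real (\<sigma> * pi / 2)) / 2)"

lemma continuous_half_root: "continuous_on A (half_root \<sigma>)"
  unfolding half_root_def by (intro continuous_on_exp continuous_on_divide continuous_on_diff continuous_on_const continuous_on_id) simp

lemma continuous_half_dir: "continuous_on A (\<lambda>p. half_dir (snd (fst p)) (snd p))"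
  unfolding half_dir_def Let_def
  by (intro continuous_on_add continuous_on_mult continuous_on_diff continuous_on_of_real continuous_on_norm
      continuous_on_Im continuous_on_const continuous_on_fst continuous_on_snd continuous_on_id)

lemma half_root_square:
  assumes "\<sigma> \<in> {1, -1}"
  shows "(half_root \<sigma> z)\<^sup>2 = - \<i> * of_real \<sigma> * exp z"
proof -
  have "(half_root \<sigma> z)\<^sup>2 = exp (z - \<i> * of_real (\<sigma> * pi / 2))"
  proof -
    have "(exp (w / 2))\<^sup>2 = exp w" for w :: complex by (simp flip: exp_double)
    then show ?thesis by (simp only: half_root_def)
  qed
  also have "\<dots> = exp z * exp (- \<i> * of_real (\<sigma> * pi / 2))"
    by (simp only: exp_add[symmetric]) simp
  also have "exp (- \<i> * of_real (\<sigma> * pi / 2)) = - \<i> * of_real \<sigma>"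
  proof -
    have "exp (- \<i> * of_real (\<sigma> * pi / 2)) = cis (- (\<sigma> * pi / 2))"
      unfolding cis_conv_exp by simp
    then show ?thesis using assms by (auto simp: complex_eq_iff)
  qed
  finally show ?thesis by (simp add: mult_ac)
qed

definition reflecting_piece :: "real \<Rightarrow> real \<Rightarrow> ((complex \<times> complex) \<times> real) set" where
  "reflecting_piece \<sigma> l = {((z, e), k). - pi < Im z \<and> Im z < 2 * pi \<and> reflecting e k \<and>
      Im (half_dir e k * (of_real l * half_root \<sigma> z)) > 0}"

text \<open>
  The product of \<open>half_dir\<close> and \<open>half_root\<close> is a square root of \<open>r'\<close> rotated so that the forbidden
  half-axis becomes the positive real axis.  A complex number is real exactly when its square lies
  on that axis.
\<close>
lemma reduced_reflecting_eq:
  assumes "\<sigma> \<in> {1, -1}"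
  shows "reduced (-1) \<sigma> = reflecting_piece \<sigma> 1 \<union> reflecting_piece \<sigma> (-1)"
proof -
  have *: "Im (half_dir e k * half_root \<sigma> z) = 0 \<longleftrightarrow>
     Re (exp z * (1 + of_real k * e)) = 0 \<and> \<sigma> * Im (exp z * (1 + of_real k * e)) \<ge> 0" if "reflecting e k" for z e k
  proof -
    have nz: "half_root \<sigma> z \<noteq> 0" by (simp add: half_root_def)
    define r where "r = exp z * (1 + of_real k * e)"
    have eq: "(half_root \<sigma> z)\<^sup>2 * (1 + of_real k * e) = - \<i> * of_real \<sigma> * r"
      using half_root_square[OF assms] by (simp add: r_def mult_ac)
    show ?thesis
      unfolding half_dir_real_iff[OF that nz] eq r_def[symmetric] using assms by auto
  qed
  have "((z, e), k) \<in> reduced (-1) \<sigma> \<longleftrightarrow> - pi < Im z \<and> Im z < 2 * pi \<and> reflecting e k \<and> Im (half_dir e k * half_root \<sigma> z) \<noteq> 0" for z e k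
  proof -
    have "- 1 * (1 + k * Re e) \<le> 0 \<longleftrightarrow> 1 + k * Re e \<ge> 0" by auto
    then show ?thesis using * unfolding reduced_def mem_Collect_eq case_prod_conv by blast
  qed
  moreover have "((z, e), k) \<in> reflecting_piece \<sigma> 1 \<union> reflecting_piece \<sigma> (-1) \<longleftrightarrow> - pi < Im z \<and> Im z < 2 * pi \<and> reflecting e k \<and> Im (half_dir e k * half_root \<sigma> z) \<noteq> 0" for z e k
  proof -
    have "half_dir e k * (complex_of_real 1 * half_root \<sigma> z) = half_dir e k * half_root \<sigma> z"
      "half_dir e k * (complex_of_real (-1) * half_root \<sigma> z) = - (half_dir e k * half_root \<sigma> z)" by simp_all
    then show ?thesis unfolding reflecting_piece_def Un_iff mem_Collect_eq case_prod_conv by (simp del: times_complex.sel) linarith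
  qed
  ultimately have "p \<in> reduced (-1) \<sigma> \<longleftrightarrow> p \<in> reflecting_piece \<sigma> 1 \<union> reflecting_piece \<sigma> (-1)" for p
    by (metis prod.exhaust)
  then show ?thesis by blast
qed

lemma open_reflecting_piece: "open (reflecting_piece \<sigma> l)"
proof -
  have eq: "reflecting_piece \<sigma> l = {p. - pi < Im (fst (fst p)) \<and> Im (fst (fst p)) < 2 * pi \<and>
      (Im (snd (fst p)) \<noteq> 0 \<or> 1 + snd p * Re (snd (fst p)) < 0) \<and>
      Im (half_dir (snd (fst p)) (snd p) * (of_real l * half_root \<sigma> (fst (fst p)))) > 0}"
    by (auto simp: reflecting_piece_def)
  have f: "continuous_on UNIV (\<lambda>p :: (complex \<times> complex) \<times> real. fst (fst p))"
    by (intro continuous_on_fst continuous_on_id)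
  have h: "continuous_on UNIV (\<lambda>p :: (complex \<times> complex) \<times> real. half_root \<sigma> (fst (fst p)))"
    by (rule continuous_on_compose2[OF continuous_half_root[of UNIV] f]) simp
  have c: "continuous_on UNIV (\<lambda>p. Im (half_dir (snd (fst p)) (snd p) * (of_real l * half_root \<sigma> (fst (fst p)))))"
    by (rule continuous_on_Im[OF continuous_on_mult[OF continuous_half_dir continuous_on_mult[OF continuous_on_const h]]])
  have o: "open {p :: (complex \<times> complex) \<times> real. - pi < Im (fst (fst p))}" "open {p :: (complex \<times> complex) \<times> real. Im (fst (fst p)) < 2 * pi}"
      "open {p :: (complex \<times> complex) \<times> real. 1 + snd p * Re (snd (fst p)) < 0}"
      "open {p :: (complex \<times> complex) \<times> real. Im (snd (fst p)) \<noteq> 0}"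
    by (intro open_Collect_less open_Collect_neq continuous_intros)+
  show ?thesis
    unfolding eq
    by (intro open_Collect_conj open_Collect_disj o open_Collect_less continuous_on_const c)
qed

text \<open>
  Forgetting \<open>k\<close> leaves a sector of values \<open>e\<close> over each \<open>z\<close>; the sector contracts to its centre, and the
  values of \<open>z\<close> form a convex strip.
\<close>
lemma contractible_reflecting_piece:
  assumes "l \<noteq> 0"
  shows "contractible (reflecting_piece \<sigma> l)"
proof (rule contractible_convex_fibres[OF open_reflecting_piece])
  fix p :: "complex \<times> complex"
  obtain z e where p: "p = (z, e)" by (cases p)
  show "convex {k. (p, k) \<in> reflecting_piece \<sigma> l}"
  proof (cases "- pi < Im z \<and> Im z < 2 * pi")
    case True
    then show ?thesis using convex_half_dir_fibre[of e "of_real l * half_root \<sigma> z"] by (simp add: p reflecting_piece_def)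
  qed (auto simp: p reflecting_piece_def)
next
  let ?S = "{z. - pi < Im z \<and> Im z < 2 * pi}"
  define \<omega> where "\<omega> = (\<lambda>z. of_real l * half_root \<sigma> z)"
  have nz: "\<omega> z \<noteq> 0" for z using assms by (simp add: \<omega>_def half_root_def)
  let ?E = "{(z, e). z \<in> ?S \<and> e \<in> reflecting_sector (\<omega> z)}"
  have img: "fst ` reflecting_piece \<sigma> l = ?E"
  proof -
    have "p \<in> fst ` reflecting_piece \<sigma> l \<longleftrightarrow> p \<in> ?E" for p
    proof -
      obtain z e where p: "p = (z, e)" by (cases p)
      have "p \<in> fst ` reflecting_piece \<sigma> l \<longleftrightarrow> (\<exists>k. (p, k) \<in> reflecting_piece \<sigma> l)" by force
      also have "\<dots> \<longleftrightarrow> z \<in> ?S \<and> (\<exists>k. reflecting e k \<and> Im (half_dir e k * \<omega> z) > 0)"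
        unfolding p reflecting_piece_def \<omega>_def mem_Collect_eq case_prod_conv by blast
      also have "\<dots> \<longleftrightarrow> p \<in> ?E"
        unfolding reflecting_sector_iff[OF nz] by (simp only: p mem_Collect_eq case_prod_conv)
      finally show ?thesis .
    qed
    then show ?thesis by blast
  qed
  have cont: "continuous_on A \<omega>" for A
    unfolding \<omega>_def by (intro continuous_on_mult continuous_on_const continuous_half_root)
  have cont': "continuous_on A (\<lambda>p. - 1 / \<omega> (fst p))" for A :: "(complex \<times> complex) set"
    by (rule continuous_on_divide[OF continuous_on_const continuous_on_compose2[OF cont[of UNIV] continuous_on_fst[OF continuous_on_id]]])
       (simp_all add: nz)
  let ?g = "\<lambda>z. (z, - 1 / \<omega> z)"
  have center: "- 1 / \<omega> z \<in> reflecting_sector (\<omega> z)" for z using reflecting_sector_center[OF nz] .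
  have "homotopic_with (\<lambda>x. True) (top_of_set ?E) (top_of_set ?E) (?g \<circ> fst) id"
  proof (rule homotopic_with_linear)
    show "continuous_on ?E (?g \<circ> fst)"
      unfolding o_def by (rule continuous_on_Pair[OF continuous_on_fst[OF continuous_on_id] cont'])
    show "continuous_on ?E id" by (rule continuous_on_id')
    fix p assume "p \<in> ?E"
    then obtain z e where p: "p = (z, e)" "z \<in> ?S" "e \<in> reflecting_sector (\<omega> z)" by auto
    show "closed_segment ((?g \<circ> fst) p) (id p) \<subseteq> ?E"
    proof
      fix x assume "x \<in> closed_segment ((?g \<circ> fst) p) (id p)"
      then have "(fst x, snd x) \<in> closed_segment (z, - 1 / \<omega> z) (z, e)" by (simp add: p(1))
      from closed_segment_PairD[OF this] have "fst x = z" "snd x \<in> closed_segment e (- 1 / \<omega> z)"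
        by (simp_all add: closed_segment_commute)
      then show "x \<in> ?E" using reflecting_sector_star[OF nz p(3)] p(2) by (cases x) auto
    qed
  qed
  moreover have "contractible ?S"
  proof (rule convex_imp_contractible)
    have "?S = {z. - pi < Im z} \<inter> {z. Im z < 2 * pi}" by auto
    then show "convex ?S" by (simp only:) (intro convex_Int convex_halfspace_Im_gt convex_halfspace_Im_lt)
  qed
  moreover have "continuous_map (top_of_set ?S) (top_of_set ?E) ?g"
  proof -
    have "continuous_on ?S ?g"
      by (rule continuous_on_Pair[OF continuous_on_id continuous_on_divide[OF continuous_on_const cont]]) (simp add: nz)
    then show ?thesis using center by (auto simp: continuous_map_subtopology_eu)
  qed
  moreover have "continuous_map (top_of_set ?E) (top_of_set ?S) fst"
    by (auto simp: continuous_map_subtopology_eu continuous_on_fst)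
  ultimately have "contractible ?E"
    using homotopy_dominated_contractibility[of "top_of_set ?S" "top_of_set ?E" ?g fst] by simp
  then show "contractible (fst ` reflecting_piece \<sigma> l)" by (simp only: img)
qed

lemma reflecting_piece_nonempty:
  assumes "l \<noteq> 0"
  shows "reflecting_piece \<sigma> l \<noteq> {}"
proof -
  define \<omega> where "\<omega> = of_real l * half_root \<sigma> 0"
  have nz: "\<omega> \<noteq> 0" using assms by (simp add: \<omega>_def half_root_def)
  then have "- 1 / \<omega> \<in> reflecting_sector \<omega>" by (rule reflecting_sector_center)
  then obtain k where "reflecting (- 1 / \<omega>) k \<and> Im (half_dir (- 1 / \<omega>) k * \<omega>) > 0"
    using reflecting_sector_iff[OF nz] by blast
  then have "((0, - 1 / \<omega>), k) \<in> reflecting_piece \<sigma> l"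
    by (simp add: reflecting_piece_def \<omega>_def del: times_complex.sel)
  then show ?thesis by blast
qed

lemma contractible_pieces_reduced_reflecting:
  assumes "\<sigma> \<in> {1, -1}"
  shows "contractible_pieces (reduced (-1) \<sigma>) 2"
proof -
  have "reflecting_piece \<sigma> 1 \<inter> reflecting_piece \<sigma> (-1) = {}" by (auto simp: reflecting_piece_def)
  then have "contractible_pieces (reflecting_piece \<sigma> 1 \<union> reflecting_piece \<sigma> (-1)) (1 + 1)"
    by (intro contractible_pieces_Un_open contractible_pieces_1 contractible_reflecting_piece reflecting_piece_nonempty
        open_reflecting_piece) auto
  then show ?thesis unfolding reduced_reflecting_eq[OF assms] by (simp add: numeral_2_eq_2)
qed

section \<open>The reduced space, orientation-preserving case\<close>

text \<open>
  The angle of \<open>r' = exp z * (1 + k * e)\<close> is continued from that of \<open>exp z\<close>, and is thus a real number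
  rather than a residue modulo \<open>2 \<pi>\<close>.
\<close>
definition window :: "real \<Rightarrow> real set \<Rightarrow> ((complex \<times> complex) \<times> real) set" where
  "window b K = {((z, e), k). - pi < Im z \<and> Im z < 2 * pi \<and> k \<in> K \<and> 1 + of_real k * e \<notin> \<real>\<^sub>\<le>\<^sub>0 \<and>
     b < Im (z + Ln (1 + of_real k * e)) \<and> Im (z + Ln (1 + of_real k * e)) < b + 2 * pi}"

text \<open>
  The same set with \<open>z\<close> as the last coordinate, the position from which it can be eliminated.
\<close>
definition window_swap :: "real \<Rightarrow> real set \<Rightarrow> ((real \<times> complex) \<times> complex) set" where
  "window_swap b K = {((k, e), z). - pi < Im z \<and> Im z < 2 * pi \<and> k \<in> K \<and> 1 + of_real k * e \<notin> \<real>\<^sub>\<le>\<^sub>0 \<and>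
     b < Im (z + Ln (1 + of_real k * e)) \<and> Im (z + Ln (1 + of_real k * e)) < b + 2 * pi}"

definition ratio_preimage :: "complex set \<Rightarrow> real set \<Rightarrow> (real \<times> complex) set" where
  "ratio_preimage C K = {(k, e). k \<in> K \<and> 1 + of_real k * e \<in> C}"

lemma open_window_swap:
  assumes "open K"
  shows "open (window_swap b K)"
proof -
  let ?w = "\<lambda>p :: (real \<times> complex) \<times> complex. 1 + complex_of_real (fst (fst p)) * snd (fst p)"
  let ?D = "?w -` (- \<real>\<^sub>\<le>\<^sub>0)"
  let ?f = "\<lambda>p. (snd p, snd p + Ln (?w p), fst (fst p))"
  let ?T = "({z. - pi < Im z} \<inter> {z. Im z < 2 * pi}) \<times> ({z. b < Im z} \<inter> {z. Im z < b + 2 * pi}) \<times> K"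
  have cw: "continuous_on A ?w" for A by (intro continuous_intros)
  have oD: "open ?D"
    by (rule open_vimage[OF _ cw]) (simp add: open_Compl closed_nonpos_Reals_complex)
  have "continuous_on ?D (\<lambda>p. Ln (?w p))"
    by (rule continuous_on_Ln'[OF cw]) auto
  then have "continuous_on ?D ?f"
    by (intro continuous_on_Pair continuous_on_add continuous_on_snd continuous_on_fst continuous_on_id)
  moreover have "open ?T"
    by (intro open_Times open_Int open_halfspace_Im_gt open_halfspace_Im_lt assms)
  ultimately have "open (?D \<inter> ?f -` ?T)"
    by (rule continuous_open_preimage[OF _ oD])
  moreover have "window_swap b K = ?D \<inter> ?f -` ?T" by (auto simp: window_swap_def)
  ultimately show ?thesis by simp
qed

lemma window_homeomorphic:
  "window b K homeomorphic window_swap b K"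
  unfolding homeomorphic_def
proof (intro exI homeomorphismI)
  let ?f = "\<lambda>p :: (complex \<times> complex) \<times> real. ((snd p, snd (fst p)), fst (fst p))"
  let ?g = "\<lambda>p :: (real \<times> complex) \<times> complex. ((snd p, snd (fst p)), fst (fst p))"
  show "continuous_on (window b K) ?f" "continuous_on (window_swap b K) ?g"
    by (intro continuous_on_Pair continuous_on_fst continuous_on_snd continuous_on_id)+
  show "?f ` window b K \<subseteq> window_swap b K" "?g ` window_swap b K \<subseteq> window b K" by (auto simp: window_def window_swap_def)
qed auto

lemma open_window:
  assumes "open K" shows "open (window b K)"
proof -
  let ?f = "\<lambda>p :: (complex \<times> complex) \<times> real. ((snd p, snd (fst p)), fst (fst p))"
  have c: "continuous_on UNIV ?f" by (intro continuous_on_Pair continuous_on_fst continuous_on_snd continuous_on_id)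
  have "open (?f -` window_swap b K)"
    by (rule open_vimage[OF open_window_swap[OF assms] c])
  also have "\<dots> = window b K" by (auto simp: window_def window_swap_def)
  finally show ?thesis .
qed

text \<open>
  For fixed \<open>(k, e)\<close> the admissible \<open>z\<close> form the intersection of two horizontal strips.  It is nonempty
  exactly when the angle of \<open>1 + k e\<close> allows \<open>(- \<pi>, 2 \<pi>)\<close>, shifted by it, to meet the window.
\<close>
lemma contractible_window:
  assumes K: "open K" and C: "C = {w. w \<notin> \<real>\<^sub>\<le>\<^sub>0 \<and> b - 2 * pi < Im (Ln w) \<and> Im (Ln w) < b + 3 * pi}"
    and con: "contractible (ratio_preimage C K)" and ne: "ratio_preimage C K \<noteq> {}"
  shows "contractible (window b K)" "window b K \<noteq> {}"
proof -
  have fib: "(\<exists>z. - pi < Im z \<and> Im z < 2 * pi \<and> b < Im (z + u) \<and> Im (z + u) < b + 2 * pi) \<longleftrightarrow>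
      b - 2 * pi < Im u \<and> Im u < b + 3 * pi" for u
  proof
    assume "b - 2 * pi < Im u \<and> Im u < b + 3 * pi"
    then have "max (- pi) (b - Im u) < min (2 * pi) (b + 2 * pi - Im u)" by auto
    then obtain y where "max (- pi) (b - Im u) < y" "y < min (2 * pi) (b + 2 * pi - Im u)" using dense by blast
    then show "\<exists>z. - pi < Im z \<and> Im z < 2 * pi \<and> b < Im (z + u) \<and> Im (z + u) < b + 2 * pi"
      by (intro exI[of _ "\<i> * of_real y"]) auto
  qed auto
  have "p \<in> fst ` window_swap b K \<longleftrightarrow> p \<in> ratio_preimage C K" for p
  proof -
    obtain k e where p: "p = (k, e)" by (cases p)
    have "p \<in> fst ` window_swap b K \<longleftrightarrow> (\<exists>z. (p, z) \<in> window_swap b K)" by force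
    also have "\<dots> \<longleftrightarrow> k \<in> K \<and> 1 + of_real k * e \<notin> \<real>\<^sub>\<le>\<^sub>0 \<and> (\<exists>z. - pi < Im z \<and> Im z < 2 * pi \<and>
        b < Im (z + Ln (1 + of_real k * e)) \<and> Im (z + Ln (1 + of_real k * e)) < b + 2 * pi)"
      unfolding p window_swap_def mem_Collect_eq case_prod_conv by blast
    also have "\<dots> \<longleftrightarrow> p \<in> ratio_preimage C K"
      unfolding fib by (auto simp: ratio_preimage_def C p)
    finally show ?thesis .
  qed
  then have img: "fst ` window_swap b K = ratio_preimage C K" by blast
  have "contractible (window_swap b K)"
  proof (rule contractible_convex_fibres[OF open_window_swap[OF K]])
    fix p :: "real \<times> complex"
    obtain k e where p: "p = (k, e)" by (cases p)
    let ?u = "Im (Ln (1 + of_real k * e))"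
    have "{z. (p, z) \<in> window_swap b K} = (if k \<in> K \<and> 1 + of_real k * e \<notin> \<real>\<^sub>\<le>\<^sub>0 then
       {z. Im z > - pi} \<inter> {z. Im z < 2 * pi} \<inter> ({z. Im z > b - ?u} \<inter> {z. Im z < b + 2 * pi - ?u}) else {})"
      by (auto simp: p window_swap_def)
    then show "convex {z. (p, z) \<in> window_swap b K}"
      by (simp only: split: if_split) (auto intro!: convex_Int convex_halfspace_Im_gt convex_halfspace_Im_lt)
  next
    show "contractible (fst ` window_swap b K)" unfolding img by (rule con)
  qed
  then show "contractible (window b K)"
    by (simp only: homeomorphic_contractible_eq[OF window_homeomorphic])
  obtain k e where "(k, e) \<in> fst ` window_swap b K" using ne img by auto
  then obtain z where "((k, e), z) \<in> window_swap b K" by auto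
  then have "((z, e), k) \<in> window b K" by (simp add: window_def window_swap_def)
  then show "window b K \<noteq> {}" by blast
qed

text \<open>
  Shrinking \<open>e\<close> to \<open>0\<close> moves \<open>1 + k e\<close> to \<open>1\<close> along a segment.
\<close>
lemma contractible_ratio_preimage_star:
  assumes "\<And>w. w \<in> C \<Longrightarrow> closed_segment w 1 \<subseteq> C" "1 \<in> C"
  shows "contractible (ratio_preimage C UNIV)"
proof -
  let ?E = "ratio_preimage C UNIV" and ?g = "\<lambda>k. (k, 0)"
  have "homotopic_with (\<lambda>x. True) (top_of_set ?E) (top_of_set ?E) (?g \<circ> fst) id"
  proof (rule homotopic_with_linear)
    show "continuous_on ?E (?g \<circ> fst)"
      unfolding o_def by (intro continuous_on_Pair continuous_on_fst continuous_on_id continuous_on_const)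
    show "continuous_on ?E id" by (rule continuous_on_id')
    fix p assume "p \<in> ?E"
    then obtain k e where p: "p = (k, e)" "1 + of_real k * e \<in> C" by (auto simp: ratio_preimage_def)
    show "closed_segment ((?g \<circ> fst) p) (id p) \<subseteq> ?E"
    proof
      fix x assume "x \<in> closed_segment ((?g \<circ> fst) p) (id p)"
      then have "(fst x, snd x) \<in> closed_segment (k, 0) (k, e)" by (simp add: p(1))
      from closed_segment_PairD[OF this] have x: "fst x = k" "snd x \<in> closed_segment 0 e"
        by simp_all
      then obtain t where t: "0 \<le> t" "t \<le> 1" "snd x = t *\<^sub>R e" by (auto simp: closed_segment_def)
      have "1 + of_real k * snd x = (1 - t) *\<^sub>R 1 + t *\<^sub>R (1 + of_real k * e)"
        by (simp add: t scaleR_conv_of_real algebra_simps)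
      then have "1 + of_real k * snd x \<in> closed_segment 1 (1 + of_real k * e)"
        using t by (auto simp only: closed_segment_def)
      then have "1 + of_real k * snd x \<in> C"
        using assms(1)[OF p(2)] by (auto simp: closed_segment_commute)
      then show "x \<in> ?E" using x by (cases x) (auto simp: ratio_preimage_def)
    qed
  qed
  moreover have "continuous_map (top_of_set (UNIV :: real set)) (top_of_set ?E) ?g"
  proof -
    have "continuous_on UNIV ?g" by (intro continuous_on_Pair continuous_on_id continuous_on_const)
    moreover have "range ?g \<subseteq> ?E" using assms(2) by (auto simp: ratio_preimage_def)
    ultimately show ?thesis unfolding continuous_map_subtopology_eu by auto
  qed
  moreover have "continuous_map (top_of_set ?E) (top_of_set (UNIV :: real set)) fst"
    by (auto simp: continuous_on_fst)
  moreover have "contractible_space (top_of_set (UNIV :: real set))"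
    by (simp only: contractible_space_top_of_set contractible_UNIV)
  ultimately show ?thesis
    using homotopy_dominated_contractibility[of "top_of_set (UNIV :: real set)" "top_of_set ?E" ?g fst] by simp
qed

text \<open>
  For \<open>k \<noteq> 0\<close> the number \<open>e\<close> depends affinely on \<open>1 + k e\<close>, so the fibres over \<open>k\<close> inherit convexity
  from \<open>C\<close>.
\<close>
lemma contractible_ratio_preimage_convex:
  assumes "open C" "convex C" "C \<noteq> {}" "open K" "convex K" "0 \<notin> K"
  shows "contractible (ratio_preimage C K)"
proof (rule contractible_convex_fibres)
  let ?f = "\<lambda>p. (fst p, 1 + complex_of_real (fst p) * snd p)"
  have c: "continuous_on UNIV ?f" by (intro continuous_intros)
  have "ratio_preimage C K = ?f -` (K \<times> C)" by (auto simp: ratio_preimage_def)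
  then show "open (ratio_preimage C K)"
    using open_vimage[OF open_Times[OF assms(4,1)] c] by simp
  fix k :: real
  have "{e. (k, e) \<in> ratio_preimage C K} = (if k \<in> K then (\<lambda>e. 1 + of_real k * e) -` C else {})"
    by (auto simp: ratio_preimage_def)
  moreover have "convex ((\<lambda>e. 1 + complex_of_real k * e) -` C)"
  proof -
    have "(\<lambda>e. 1 + complex_of_real k * e) -` C = (*) (complex_of_real k) -` ((\<lambda>x. - 1 + x) ` C)"
      by force
    moreover have "linear ((*) (complex_of_real k))"
      by (simp add: linear_times)
    ultimately show ?thesis
      using assms(2) by (simp add: convex_linear_vimage convex_translation)
  qed
  ultimately show "convex {e. (k, e) \<in> ratio_preimage C K}" by simp
next
  obtain c where c: "c \<in> C" using assms(3) by blast
  have "k \<in> fst ` ratio_preimage C K" if "k \<in> K" for k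
  proof -
    have "k \<noteq> 0" using that assms(6) by auto
    then have "(k, (c - 1) / of_real k) \<in> ratio_preimage C K" using that c by (simp add: ratio_preimage_def)
    then show ?thesis by force
  qed
  then have "fst ` ratio_preimage C K = K" by (auto simp: ratio_preimage_def)
  then show "contractible (fst ` ratio_preimage C K)" using assms(5) by (simp add: convex_imp_contractible)
qed

lemma Ln_slit_bounds:
  assumes "w \<notin> \<real>\<^sub>\<le>\<^sub>0" shows "- pi < Im (Ln w)" "Im (Ln w) < pi" "w \<noteq> 0"
proof -
  show "w \<noteq> 0" using assms by auto
  then show "- pi < Im (Ln w)" "Im (Ln w) < pi"
    using assms mpi_less_Im_Ln[of w] Im_Ln_less_pi[of w] by (auto simp: complex_nonpos_Reals_iff)
qed

lemma slit_iff: "1 + of_real k * e \<notin> \<real>\<^sub>\<le>\<^sub>0 \<longleftrightarrow> \<not> (Im e = 0 \<and> 1 + k * Re e \<le> 0)"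
  by (cases "k = 0") (auto simp: complex_nonpos_Reals_iff)

lemma reduced_direct_iff:
  "((z, e), k) \<in> reduced 1 \<sigma> \<longleftrightarrow> - pi < Im z \<and> Im z < 2 * pi \<and> 1 + of_real k * e \<notin> \<real>\<^sub>\<le>\<^sub>0 \<and>
     \<not> (cos (Im (z + Ln (1 + of_real k * e))) = 0 \<and> \<sigma> * sin (Im (z + Ln (1 + of_real k * e))) \<ge> 0)"
proof (cases "1 + of_real k * e \<in> \<real>\<^sub>\<le>\<^sub>0")
  case True
  then show ?thesis using slit_iff[of k e] by (auto simp: reduced_def simp del: times_complex.sel)
next
  case False
  define w where "w = 1 + of_real k * e"
  have "w \<noteq> 0" using False by (auto simp: w_def)
  then have r: "exp z * w = exp (z + Ln w)" by (simp add: exp_add)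
  define u where "u = z + Ln w"
  have "Re (exp z * w) = 0 \<and> \<sigma> * Im (exp z * w) \<ge> 0 \<longleftrightarrow> cos (Im u) = 0 \<and> \<sigma> * sin (Im u) \<ge> 0"
  proof -
    have "\<sigma> * (exp (Re u) * sin (Im u)) = exp (Re u) * (\<sigma> * sin (Im u))" by simp
    moreover have "0 \<le> exp (Re u) * x \<longleftrightarrow> 0 \<le> x" for x by (simp add: zero_le_mult_iff)
    ultimately have "0 \<le> \<sigma> * (exp (Re u) * sin (Im u)) \<longleftrightarrow> 0 \<le> \<sigma> * sin (Im u)" by (simp only:)
    then show ?thesis unfolding r u_def[symmetric] Re_exp Im_exp by simp
  qed
  then show ?thesis using False slit_iff[of k e] unfolding reduced_def w_def u_def by (simp del: times_complex.sel) blast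
qed

lemma sin_eq_1_window:
  assumes "- 2 * pi < \<theta>" "\<theta> < 3 * pi"
  shows "cos \<theta> = 0 \<and> sin \<theta> \<ge> 0 \<longleftrightarrow> \<theta> = - 3 * pi / 2 \<or> \<theta> = pi / 2 \<or> \<theta> = 5 * pi / 2"
proof -
  have "cos \<theta> = 0 \<and> sin \<theta> \<ge> 0 \<longleftrightarrow> sin \<theta> = 1"
    using sin_cos_squared_add[of \<theta>] by (auto simp: power2_eq_1_iff simp del: sin_cos_squared_add)
  also have "\<dots> \<longleftrightarrow> \<theta> = - 3 * pi / 2 \<or> \<theta> = pi / 2 \<or> \<theta> = 5 * pi / 2"
  proof
    assume "sin \<theta> = 1"
    then obtain n :: int where n: "\<theta> = (2 * n + 1 / 2) * pi" by (auto simp: sin_eq_1)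
    have "(- 2) * pi < (2 * n + 1 / 2) * pi" "(2 * n + 1 / 2) * pi < 3 * pi" using assms n by auto
    then have "- 2 < 2 * real_of_int n + 1 / 2" "2 * real_of_int n + 1 / 2 < 3"
      by (simp_all only: mult_less_cancel_right_pos pi_gt_zero)
    then have "n = -1 \<or> n = 0 \<or> n = 1" by linarith
    then show "\<theta> = - 3 * pi / 2 \<or> \<theta> = pi / 2 \<or> \<theta> = 5 * pi / 2" using n by auto
  next
    assume "\<theta> = - 3 * pi / 2 \<or> \<theta> = pi / 2 \<or> \<theta> = 5 * pi / 2"
    then have "\<theta> = (2 * real_of_int (-1) + 1 / 2) * pi \<or> \<theta> = (2 * real_of_int 0 + 1 / 2) * pi \<or> \<theta> = (2 * real_of_int 1 + 1 / 2) * pi"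
      by auto
    then show "sin \<theta> = 1" unfolding sin_eq_1 by blast
  qed
  finally show ?thesis .
qed

lemma sin_eq_minus1_window:
  assumes "- 2 * pi < \<theta>" "\<theta> < 3 * pi"
  shows "cos \<theta> = 0 \<and> - sin \<theta> \<ge> 0 \<longleftrightarrow> \<theta> = - pi / 2 \<or> \<theta> = 3 * pi / 2"
proof -
  have "cos \<theta> = 0 \<and> - sin \<theta> \<ge> 0 \<longleftrightarrow> sin \<theta> = - 1"
    using sin_cos_squared_add[of \<theta>] by (auto simp: power2_eq_1_iff simp del: sin_cos_squared_add)
  also have "\<dots> \<longleftrightarrow> \<theta> = - pi / 2 \<or> \<theta> = 3 * pi / 2"
  proof
    assume "sin \<theta> = - 1"
    then obtain n :: int where n: "\<theta> = (2 * n + 3 / 2) * pi" by (auto simp: sin_eq_minus1)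
    have "(- 2) * pi < (2 * n + 3 / 2) * pi" "(2 * n + 3 / 2) * pi < 3 * pi" using assms n by auto
    then have "- 2 < 2 * real_of_int n + 3 / 2" "2 * real_of_int n + 3 / 2 < 3"
      by (simp_all only: mult_less_cancel_right_pos pi_gt_zero)
    then have "n = -1 \<or> n = 0" by linarith
    then show "\<theta> = - pi / 2 \<or> \<theta> = 3 * pi / 2" using n by auto
  next
    assume "\<theta> = - pi / 2 \<or> \<theta> = 3 * pi / 2"
    then have "\<theta> = (2 * real_of_int (-1) + 3 / 2) * pi \<or> \<theta> = (2 * real_of_int 0 + 3 / 2) * pi" by auto
    then show "sin \<theta> = - 1" unfolding sin_eq_minus1 by blast
  qed
  finally show ?thesis .
qed

lemma cover_by_windows_plus:
  fixes p \<theta> k :: real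
  assumes "- 2 * p < \<theta>" "\<theta> < 3 * p" "k = 0 \<Longrightarrow> - p < \<theta> \<and> \<theta> < 2 * p" "0 < p"
  shows "\<not> (\<theta> = - 3 * p / 2 \<or> \<theta> = p / 2 \<or> \<theta> = 5 * p / 2) \<longleftrightarrow>
     (- 3 * p / 2 < \<theta> \<and> \<theta> < - 3 * p / 2 + 2 * p) \<or> (p / 2 < \<theta> \<and> \<theta> < p / 2 + 2 * p) \<or>
     (0 < k \<and> - 7 * p / 2 < \<theta> \<and> \<theta> < - 7 * p / 2 + 2 * p) \<or> (k < 0 \<and> - 7 * p / 2 < \<theta> \<and> \<theta> < - 7 * p / 2 + 2 * p) \<or>
     (0 < k \<and> 5 * p / 2 < \<theta> \<and> \<theta> < 5 * p / 2 + 2 * p) \<or> (k < 0 \<and> 5 * p / 2 < \<theta> \<and> \<theta> < 5 * p / 2 + 2 * p)"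
  using assms by argo
lemma cover_by_windows_minus:
  fixes p \<theta> :: real
  assumes "- 2 * p < \<theta>" "\<theta> < 3 * p" "0 < p"
  shows "\<not> (\<theta> = - p / 2 \<or> \<theta> = 3 * p / 2) \<longleftrightarrow>
     (- p / 2 < \<theta> \<and> \<theta> < - p / 2 + 2 * p) \<or> (- 5 * p / 2 < \<theta> \<and> \<theta> < - 5 * p / 2 + 2 * p) \<or>
     (3 * p / 2 < \<theta> \<and> \<theta> < 3 * p / 2 + 2 * p)"
  using assms by argo

text \<open>
  The angle of \<open>r'\<close> avoids \<open>- 3 \<pi> / 2\<close>, \<open>\<pi> / 2\<close> and \<open>5 \<pi> / 2\<close>.  In the first and the last window it
  differs from \<open>Im z\<close>, hence \<open>k \<noteq> 0\<close> there.
\<close>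
lemma reduced_direct_plus_eq:
  "reduced 1 1 = window (- 3 * pi / 2) UNIV \<union> (window (pi / 2) UNIV \<union>
    (window (- 7 * pi / 2) {0<..} \<union> (window (- 7 * pi / 2) {..<0} \<union>
    (window (5 * pi / 2) {0<..} \<union> window (5 * pi / 2) {..<0}))))" (is "_ = ?R")
proof -
  have "((z, e), k) \<in> reduced 1 1 \<longleftrightarrow> ((z, e), k) \<in> ?R" for z e k
  proof (cases "- pi < Im z \<and> Im z < 2 * pi \<and> 1 + of_real k * e \<notin> \<real>\<^sub>\<le>\<^sub>0")
    case True
    define \<theta> where "\<theta> = Im (z + Ln (1 + of_real k * e))"
    have b: "- 2 * pi < \<theta>" "\<theta> < 3 * pi" using Ln_slit_bounds[of "1 + of_real k * e"] True by (auto simp: \<theta>_def)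
    have k0: "k = 0 \<Longrightarrow> \<theta> = Im z" by (simp add: \<theta>_def)
    have ba: "((z, e), k) \<in> reduced 1 1 \<longleftrightarrow> \<not> (\<theta> = - 3 * pi / 2 \<or> \<theta> = pi / 2 \<or> \<theta> = 5 * pi / 2)"
      unfolding reduced_direct_iff \<theta>_def[symmetric] using True sin_eq_1_window[OF b] by simp
    have st: "((z, e), k) \<in> window c K \<longleftrightarrow> k \<in> K \<and> c < \<theta> \<and> \<theta> < c + 2 * pi" for c K
      unfolding window_def mem_Collect_eq case_prod_conv \<theta>_def[symmetric] using True by simp
    have "k = 0 \<Longrightarrow> - pi < \<theta> \<and> \<theta> < 2 * pi" using k0 True by simp
    from cover_by_windows_plus[OF b this pi_gt_zero] show ?thesis
      unfolding ba Un_iff st by (simp only: UNIV_I greaterThan_iff lessThan_iff simp_thms)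
  qed (auto simp: window_def reduced_direct_iff)
  then show ?thesis by auto
qed

text \<open>
  The angle of \<open>r'\<close> avoids \<open>- \<pi> / 2\<close> and \<open>3 \<pi> / 2\<close>; each of the three windows contains values of \<open>Im z\<close>,
  so the sign of \<open>k\<close> can change inside it.
\<close>
lemma reduced_direct_minus_eq:
  "reduced 1 (-1) = window (- pi / 2) UNIV \<union> (window (- 5 * pi / 2) UNIV \<union> window (3 * pi / 2) UNIV)" (is "_ = ?R")
proof -
  have "((z, e), k) \<in> reduced 1 (-1) \<longleftrightarrow> ((z, e), k) \<in> ?R" for z e k
  proof (cases "- pi < Im z \<and> Im z < 2 * pi \<and> 1 + of_real k * e \<notin> \<real>\<^sub>\<le>\<^sub>0")
    case True
    define \<theta> where "\<theta> = Im (z + Ln (1 + of_real k * e))"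
    have b: "- 2 * pi < \<theta>" "\<theta> < 3 * pi" using Ln_slit_bounds[of "1 + of_real k * e"] True by (auto simp: \<theta>_def)
    have ba: "((z, e), k) \<in> reduced 1 (-1) \<longleftrightarrow> \<not> (\<theta> = - pi / 2 \<or> \<theta> = 3 * pi / 2)"
      unfolding reduced_direct_iff \<theta>_def[symmetric] using True sin_eq_minus1_window[OF b] by simp
    have st: "((z, e), k) \<in> window c K \<longleftrightarrow> k \<in> K \<and> c < \<theta> \<and> \<theta> < c + 2 * pi" for c K
      unfolding window_def mem_Collect_eq case_prod_conv \<theta>_def[symmetric] using True by simp
    from cover_by_windows_minus[OF b pi_gt_zero] show ?thesis
      unfolding ba Un_iff st by (simp only: UNIV_I simp_thms)
  qed (auto simp: window_def reduced_direct_iff)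
  then show ?thesis by auto
qed

lemma Im_Ln_slit:
  assumes "w \<notin> \<real>\<^sub>\<le>\<^sub>0"
  shows "Im (Ln w) < pi / 2 \<longleftrightarrow> Im w < 0 \<or> Re w > 0"
    and "- pi / 2 < Im (Ln w) \<longleftrightarrow> Im w > 0 \<or> Re w > 0"
    and "Im (Ln w) > pi / 2 \<longleftrightarrow> Im w > 0 \<and> Re w < 0"
    and "Im (Ln w) < - pi / 2 \<longleftrightarrow> Im w < 0 \<and> Re w < 0"
proof -
  have nz: "w \<noteq> 0" using assms by auto
  have a: "\<bar>Im (Ln w)\<bar> < pi / 2 \<longleftrightarrow> 0 < Re w" "\<bar>Im (Ln w)\<bar> \<le> pi / 2 \<longleftrightarrow> 0 \<le> Re w"
    "0 < Im (Ln w) \<longleftrightarrow> 0 < Im w" "0 \<le> Im (Ln w) \<longleftrightarrow> 0 \<le> Im w"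
    using Re_Ln_pos_lt[OF nz] Re_Ln_pos_le[OF nz] Im_Ln_pos_lt[OF nz] Im_Ln_pos_le[OF nz] Ln_slit_bounds[OF assms]
    by auto
  have s: "Im w = 0 \<Longrightarrow> Re w > 0" using assms by (auto simp: complex_nonpos_Reals_iff)
  show "Im (Ln w) < pi / 2 \<longleftrightarrow> Im w < 0 \<or> Re w > 0" using a s pi_gt_zero by argo
  show "- pi / 2 < Im (Ln w) \<longleftrightarrow> Im w > 0 \<or> Re w > 0" using a s pi_gt_zero by argo
  show "Im (Ln w) > pi / 2 \<longleftrightarrow> Im w > 0 \<and> Re w < 0" using a s pi_gt_zero by argo
  show "Im (Ln w) < - pi / 2 \<longleftrightarrow> Im w < 0 \<and> Re w < 0" using a s pi_gt_zero by argo
qed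

lemma closed_segment_1E:
  assumes "x \<in> closed_segment w 1"
  obtains t where "0 \<le> t" "t \<le> 1" "Re x = (1 - t) * Re w + t" "Im x = (1 - t) * Im w"
  using assms by (auto simp: closed_segment_def)

lemma closed_segment_right_half:
  assumes "x \<in> closed_segment w 1" "Re w > 0" shows "Re x > 0"
proof -
  obtain t where t: "0 \<le> t" "t \<le> 1" "Re x = (1 - t) * Re w + t" using assms(1) by (rule closed_segment_1E)
  have "(1 - t) * Re w \<ge> 0" using t assms(2) by simp
  then show ?thesis using t assms(2) by (cases "t = 0") (simp, linarith)
qed

lemma star_slit:
  fixes w :: complex
  assumes "w \<in> - \<real>\<^sub>\<le>\<^sub>0" shows "closed_segment w 1 \<subseteq> - \<real>\<^sub>\<le>\<^sub>0"
proof
  fix x assume x: "x \<in> closed_segment w 1"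
  obtain t where t: "0 \<le> t" "t \<le> 1" "Re x = (1 - t) * Re w + t" "Im x = (1 - t) * Im w"
    using x by (rule closed_segment_1E)
  show "x \<in> - \<real>\<^sub>\<le>\<^sub>0"
    using assms t closed_segment_right_half[OF x] by (cases "t = 1") (auto simp: complex_nonpos_Reals_iff)
qed

lemma star_lower:
  assumes "w \<in> {w. Im w < 0 \<or> Re w > 0}" shows "closed_segment w 1 \<subseteq> {w. Im w < 0 \<or> Re w > 0}"
proof
  fix x assume x: "x \<in> closed_segment w 1"
  obtain t where t: "0 \<le> t" "t \<le> 1" "Re x = (1 - t) * Re w + t" "Im x = (1 - t) * Im w"
    using x by (rule closed_segment_1E)
  show "x \<in> {w. Im w < 0 \<or> Re w > 0}"
    using assms t closed_segment_right_half[OF x] by (cases "t = 1") (auto simp: mult_less_0_iff)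
qed

lemma star_upper:
  assumes "w \<in> {w. Im w > 0 \<or> Re w > 0}" shows "closed_segment w 1 \<subseteq> {w. Im w > 0 \<or> Re w > 0}"
proof
  fix x assume x: "x \<in> closed_segment w 1"
  obtain t where t: "0 \<le> t" "t \<le> 1" "Re x = (1 - t) * Re w + t" "Im x = (1 - t) * Im w"
    using x by (rule closed_segment_1E)
  show "x \<in> {w. Im w > 0 \<or> Re w > 0}"
    using assms t closed_segment_right_half[OF x] by (cases "t = 1") (auto simp: zero_less_mult_iff)
qed

lemma contractible_pieces_window_star:
  assumes C: "C = {w. w \<notin> \<real>\<^sub>\<le>\<^sub>0 \<and> b - 2 * pi < Im (Ln w) \<and> Im (Ln w) < b + 3 * pi}"
    and star: "\<And>w. w \<in> C \<Longrightarrow> closed_segment w 1 \<subseteq> C" and 1: "1 \<in> C"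
  shows "contractible_pieces (window b UNIV) 1"
proof -
  have "(0, 0) \<in> ratio_preimage C UNIV" using 1 by (simp add: ratio_preimage_def)
  then have "ratio_preimage C UNIV \<noteq> {}" by blast
  then show ?thesis
    using contractible_window[OF open_UNIV C contractible_ratio_preimage_star[OF star 1]] contractible_pieces_1 by blast
qed

lemma contractible_pieces_window_convex:
  assumes C: "C = {w. w \<notin> \<real>\<^sub>\<le>\<^sub>0 \<and> b - 2 * pi < Im (Ln w) \<and> Im (Ln w) < b + 3 * pi}"
    and "open C" "convex C" "C \<noteq> {}" "open K" "convex K" "0 \<notin> K" "K \<noteq> {}"
  shows "contractible_pieces (window b K) 1"
proof -
  obtain c k where "c \<in> C" "k \<in> K" using assms by blast
  moreover have "k \<noteq> 0" using \<open>k \<in> K\<close> assms by auto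
  ultimately have "(k, (c - 1) / of_real k) \<in> ratio_preimage C K" by (simp add: ratio_preimage_def)
  then have "ratio_preimage C K \<noteq> {}" by blast
  then show ?thesis
    using contractible_window[OF assms(5) C contractible_ratio_preimage_convex] assms contractible_pieces_1 by blast
qed

text \<open>
  For these \<open>b\<close> the window restricts the angle of \<open>1 + k e\<close> no further than the slit plane does.
\<close>
lemma contractible_pieces_window_slit:
  assumes "b \<le> pi" "- 2 * pi \<le> b"
  shows "contractible_pieces (window b UNIV) 1"
proof (rule contractible_pieces_window_star[OF _ star_slit])
  show "- \<real>\<^sub>\<le>\<^sub>0 = {w. w \<notin> \<real>\<^sub>\<le>\<^sub>0 \<and> b - 2 * pi < Im (Ln w) \<and> Im (Ln w) < b + 3 * pi}"
    using Ln_slit_bounds assms by force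
qed auto

lemma contractible_pieces_window_lower: "contractible_pieces (window (- 5 * pi / 2) UNIV) 1"
proof (rule contractible_pieces_window_star[OF _ star_lower])
  have "w \<notin> \<real>\<^sub>\<le>\<^sub>0 \<and> - 5 * pi / 2 - 2 * pi < Im (Ln w) \<and> Im (Ln w) < - 5 * pi / 2 + 3 * pi \<longleftrightarrow> Im w < 0 \<or> Re w > 0" for w
    using Im_Ln_slit(1)[of w] Ln_slit_bounds(1)[of w]
    by (cases "w \<in> \<real>\<^sub>\<le>\<^sub>0") (auto simp: complex_nonpos_Reals_iff)
  then show "{w. Im w < 0 \<or> Re w > 0} = {w. w \<notin> \<real>\<^sub>\<le>\<^sub>0 \<and> - 5 * pi / 2 - 2 * pi < Im (Ln w) \<and> Im (Ln w) < - 5 * pi / 2 + 3 * pi}"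
    by simp
qed auto

lemma contractible_pieces_window_upper: "contractible_pieces (window (3 * pi / 2) UNIV) 1"
proof (rule contractible_pieces_window_star[OF _ star_upper])
  have "w \<notin> \<real>\<^sub>\<le>\<^sub>0 \<and> 3 * pi / 2 - 2 * pi < Im (Ln w) \<and> Im (Ln w) < 3 * pi / 2 + 3 * pi \<longleftrightarrow> Im w > 0 \<or> Re w > 0" for w
    using Im_Ln_slit(2)[of w] Ln_slit_bounds(2)[of w]
    by (cases "w \<in> \<real>\<^sub>\<le>\<^sub>0") (auto simp: complex_nonpos_Reals_iff)
  then show "{w. Im w > 0 \<or> Re w > 0} = {w. w \<notin> \<real>\<^sub>\<le>\<^sub>0 \<and> 3 * pi / 2 - 2 * pi < Im (Ln w) \<and> Im (Ln w) < 3 * pi / 2 + 3 * pi}"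
    by simp
qed auto

text \<open>
  Here \<open>r'\<close> has turned beyond every angle available to \<open>exp z\<close>, so \<open>1 + k e\<close> lies in an open quadrant
  of the left half-plane.
\<close>
lemma contractible_pieces_window_left:
  assumes "open K" "convex K" "0 \<notin> K" "K \<noteq> {}"
  shows "contractible_pieces (window (- 7 * pi / 2) K) 1" "contractible_pieces (window (5 * pi / 2) K) 1"
proof -
  have "w \<notin> \<real>\<^sub>\<le>\<^sub>0 \<and> - 7 * pi / 2 - 2 * pi < Im (Ln w) \<and> Im (Ln w) < - 7 * pi / 2 + 3 * pi \<longleftrightarrow> Im w < 0 \<and> Re w < 0" for w
    using Im_Ln_slit(4)[of w] Ln_slit_bounds(1)[of w]
    by (cases "w \<in> \<real>\<^sub>\<le>\<^sub>0") (auto simp: complex_nonpos_Reals_iff)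
  then have 1: "{w. Im w < 0} \<inter> {w. Re w < 0} = {w. w \<notin> \<real>\<^sub>\<le>\<^sub>0 \<and> - 7 * pi / 2 - 2 * pi < Im (Ln w) \<and> Im (Ln w) < - 7 * pi / 2 + 3 * pi}"
    by auto
  have "Complex (-1) (-1) \<in> {w. Im w < 0} \<inter> {w. Re w < 0}" by simp
  then have "{w. Im w < 0} \<inter> {w. Re w < 0} \<noteq> {}" by blast
  then show "contractible_pieces (window (- 7 * pi / 2) K) 1"
    by (intro contractible_pieces_window_convex[OF 1] open_Int open_halfspace_Im_lt open_halfspace_Re_lt
        convex_Int convex_halfspace_Im_lt convex_halfspace_Re_lt assms)
  have "w \<notin> \<real>\<^sub>\<le>\<^sub>0 \<and> 5 * pi / 2 - 2 * pi < Im (Ln w) \<and> Im (Ln w) < 5 * pi / 2 + 3 * pi \<longleftrightarrow> Im w > 0 \<and> Re w < 0" for w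
    using Im_Ln_slit(3)[of w] Ln_slit_bounds(2)[of w]
    by (cases "w \<in> \<real>\<^sub>\<le>\<^sub>0") (auto simp: complex_nonpos_Reals_iff)
  then have 2: "{w. Im w > 0} \<inter> {w. Re w < 0} = {w. w \<notin> \<real>\<^sub>\<le>\<^sub>0 \<and> 5 * pi / 2 - 2 * pi < Im (Ln w) \<and> Im (Ln w) < 5 * pi / 2 + 3 * pi}"
    by auto
  have "Complex (-1) 1 \<in> {w. Im w > 0} \<inter> {w. Re w < 0}" by simp
  then have "{w. Im w > 0} \<inter> {w. Re w < 0} \<noteq> {}" by blast
  then show "contractible_pieces (window (5 * pi / 2) K) 1"
    by (intro contractible_pieces_window_convex[OF 2] open_Int open_halfspace_Im_gt open_halfspace_Re_lt
        convex_Int convex_halfspace_Im_gt convex_halfspace_Re_lt assms)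
qed

lemma window_disjoint:
  assumes "K \<inter> K' = {} \<or> b + 2 * pi \<le> b' \<or> b' + 2 * pi \<le> b"
  shows "window b K \<inter> window b' K' = {}"
  using assms unfolding window_def by fastforce

lemma contractible_pieces_reduced_direct_plus: "contractible_pieces (reduced 1 1) 6"
proof -
  have s: "contractible_pieces (window (- 3 * pi / 2) UNIV) 1" "contractible_pieces (window (pi / 2) UNIV) 1"
    using pi_gt_zero by (intro contractible_pieces_window_slit; linarith)+
  have d: "{0<..} \<inter> {..<0::real} = {}" by auto
  have "contractible_pieces (reduced 1 1) (1 + (1 + (1 + (1 + (1 + 1)))))"
    unfolding reduced_direct_plus_eq
    by (intro contractible_pieces_Un_open s contractible_pieces_window_left open_window open_Un)
       (simp_all add: Int_Un_distrib window_disjoint d)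
  then show ?thesis by (simp add: numeral_eq_Suc)
qed

lemma contractible_pieces_reduced_direct_minus: "contractible_pieces (reduced 1 (-1)) 3"
proof -
  have s: "contractible_pieces (window (- pi / 2) UNIV) 1"
    using pi_gt_zero by (intro contractible_pieces_window_slit; linarith)
  have "contractible_pieces (reduced 1 (-1)) (1 + (1 + 1))"
    unfolding reduced_direct_minus_eq
    by (intro contractible_pieces_Un_open s contractible_pieces_window_lower
        contractible_pieces_window_upper open_window open_Un) (simp_all add: Int_Un_distrib window_disjoint)
  then show ?thesis by (simp add: numeral_eq_Suc)
qed

section \<open>Restoring the eliminated coordinates\<close>

text \<open>
  The inequalities for the four signed minors in the coordinates \<open>(z, e, k, s, t, y, a, j)\<close>.  With
  suitable signs \<open>s, t, y, a, j\<close> are the entries \<open>L$4$1\<close>, \<open>L$3$1\<close>, \<open>L$2$1\<close>, \<open>L$1$0\<close>, \<open>L$4$3\<close>; only the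
  products \<open>\<tau>\<close> and \<open>\<sigma>\<close> of the prescribed signs survive.  The two disjunctions make \<open>z\<close> the logarithm
  belonging to the sheet of \<open>s\<close>.
\<close>
definition solutions :: "real \<Rightarrow> real \<Rightarrow> ((complex \<times> complex) \<times> real) set \<Rightarrow>
    ((((complex \<times> complex) \<times> real) \<times> real) \<times> (real \<times> real \<times> real \<times> real)) set" where
  "solutions \<tau> \<sigma> N = {((((z, e), k), s), (t, y, a, j)). ((z, e), k) \<in> N \<and> (s > 0 \<or> Im z > 0) \<and> (s < 0 \<or> Im z < pi) \<and>
     Re (exp z) * s - Im (exp z) * t > 0 \<and> Im (exp z) + a * s > 0 \<and>
     \<tau> * (Re (exp z) * s - Im (exp z) * t + y * Im (cnj (exp z) * (exp z * e))
        + k * (Re (exp z * e) * s - Im (exp z * e) * t)) > 0 \<and>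
     j * Re (exp z * (1 + of_real k * e)) - \<sigma> * Im (exp z * (1 + of_real k * e)) > 0}"

definition sheet :: "((complex \<times> complex) \<times> real) set \<Rightarrow> (((complex \<times> complex) \<times> real) \<times> real) set" where
  "sheet N = {(((z, e), k), s). ((z, e), k) \<in> N \<and> (s > 0 \<or> Im z > 0) \<and> (s < 0 \<or> Im z < pi)}"

lemma ex_affine_pos: "c \<noteq> 0 \<Longrightarrow> \<exists>x::real. b + x * c > 0"
  by (rule exI[of _ "(1 - b) / c"]) simp

text \<open>
  Each of the coordinates \<open>t, a, y, j\<close> occurs in an affine inequality.  If its coefficient vanishes, the
  inequality is a condition on the other coordinates, and these conditions are the ones built into
  the sheets and into the reduced space.  The determinant of the vectors \<open>r\<close> and \<open>r e\<close> is
  \<open>\<bar>r\<bar>\<^sup>2 Im e\<close>, so the coefficient of \<open>y\<close> vanishes exactly for real \<open>e\<close>; then the third minor is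
  \<open>1 + k e\<close> times the second.
\<close>
lemma fst_solutions:
  assumes N: "N \<subseteq> reduced \<tau> \<sigma>" and \<tau>: "\<tau> \<in> {1, -1}"
  shows "fst ` solutions \<tau> \<sigma> N = sheet N"
proof
  show "fst ` solutions \<tau> \<sigma> N \<subseteq> sheet N" by (auto simp: solutions_def sheet_def)
  show "sheet N \<subseteq> fst ` solutions \<tau> \<sigma> N"
  proof
    fix p assume "p \<in> sheet N"
    then obtain z e k s where p: "p = (((z, e), k), s)" and n: "((z, e), k) \<in> N"
      and s: "s > 0 \<or> Im z > 0" "s < 0 \<or> Im z < pi" by (auto simp: sheet_def)
    define r where "r = exp z"
    have b: "- pi < Im z" "Im z < 2 * pi" "\<not> (Im e = 0 \<and> \<tau> * (1 + k * Re e) \<le> 0)"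
      "\<not> (Re (r * (1 + of_real k * e)) = 0 \<and> \<sigma> * Im (r * (1 + of_real k * e)) \<ge> 0)"
      using n N by (auto simp: reduced_def r_def simp del: times_complex.sel)
    have Rer: "Re r = exp (Re z) * cos (Im z)" and Imr: "Im r = exp (Re z) * sin (Im z)"
      by (simp_all add: r_def Re_exp Im_exp)
    have "\<exists>t. Re r * s + t * (- Im r) > 0"
    proof (cases "Im r = 0")
      case True
      then have "sin (Im z) = 0" by (simp add: Imr)
      then obtain n :: int where n: "Im z = of_int n * pi" by (auto simp: sin_zero_iff_int2)
      have "(- 1) * pi < n * pi" "n * pi < 2 * pi" using b n by auto
      then have "- 1 < real_of_int n" "real_of_int n < 2" by (simp_all only: mult_less_cancel_right_pos pi_gt_zero)
      then have "n = 0 \<or> n = 1" by linarith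
      then have "Re r * s > 0"
        using n s by (auto simp: Rer zero_less_mult_iff mult_less_0_iff)
      then show ?thesis by (intro exI[of _ 0]) simp
    qed (rule ex_affine_pos, simp)
    then obtain t where t: "Re r * s - Im r * t > 0" by (auto simp: algebra_simps)
    have "\<exists>a. Im r + a * s > 0"
    proof (cases "s = 0")
      case True
      then have "sin (Im z) > 0" using s sin_gt_zero by auto
      then show ?thesis using True by (simp add: Imr)
    qed (rule ex_affine_pos)
    then obtain a where a: "Im r + a * s > 0" by blast
    have "\<exists>y. \<tau> * (Re r * s - Im r * t + k * (Re (r * e) * s - Im (r * e) * t)) + y * (\<tau> * Im (cnj r * (r * e))) > 0"
    proof (cases "Im e = 0")
      case True
      have "Re r * s - Im r * t + k * (Re (r * e) * s - Im (r * e) * t) = (1 + k * Re e) * (Re r * s - Im r * t)"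
        using True by (simp add: algebra_simps)
      moreover have "\<tau> * (1 + k * Re e) * (Re r * s - Im r * t) > 0" using b(3) t True by simp
      ultimately show ?thesis by (intro exI[of _ 0]) (simp add: mult.assoc)
    next
      case False
      have "Im (cnj r * (r * e)) = (norm r)\<^sup>2 * Im e"
        unfolding cmod_power2 by (simp add: power2_eq_square algebra_simps)
      then have "\<tau> * Im (cnj r * (r * e)) \<noteq> 0" using False \<tau> by (auto simp: r_def simp del: times_complex.sel)
      then show ?thesis by (rule ex_affine_pos)
    qed
    then obtain y where y: "\<tau> * (Re r * s - Im r * t + y * Im (cnj r * (r * e)) + k * (Re (r * e) * s - Im (r * e) * t)) > 0"
      by (auto simp: distrib_left mult_ac add_ac simp del: times_complex.sel)
    have "\<exists>j. - (\<sigma> * Im (r * (1 + of_real k * e))) + j * Re (r * (1 + of_real k * e)) > 0"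
    proof (cases "Re (r * (1 + of_real k * e)) = 0")
      case True
      then have "\<sigma> * Im (r * (1 + of_real k * e)) < 0" using b(4) by auto
      then show ?thesis by (intro exI[of _ 0]) (simp del: times_complex.sel)
    qed (rule ex_affine_pos)
    then obtain j where j: "j * Re (r * (1 + of_real k * e)) - \<sigma> * Im (r * (1 + of_real k * e)) > 0"
      by (auto simp: algebra_simps simp del: times_complex.sel)
    have "(p, (t, y, a, j)) \<in> solutions \<tau> \<sigma> N"
      using n s t a y j unfolding p solutions_def r_def by simp
    then show "p \<in> fst ` solutions \<tau> \<sigma> N" by force
  qed
qed

lemma ex_sheet: "\<exists>s::real. (s > 0 \<or> Im z > 0) \<and> (s < 0 \<or> Im z < pi)"
proof (cases "Im z > 0")
  case True
  then show ?thesis by (intro exI[of _ "-1"]) simp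
next
  case False
  then have "Im z < pi" using pi_gt_zero by linarith
  then show ?thesis by (intro exI[of _ 1]) simp
qed

lemma open_sheet:
  assumes "open N" shows "open (sheet N)"
proof -
  have eq: "sheet N = (N \<times> UNIV) \<inter> {p. (snd p > 0 \<or> Im (fst (fst (fst p))) > 0) \<and> (snd p < 0 \<or> Im (fst (fst (fst p))) < pi)}"
    by (auto simp: sheet_def)
  show ?thesis unfolding eq
    by (intro open_Int open_Times assms open_UNIV open_Collect_conj open_Collect_disj open_Collect_less
        continuous_on_const continuous_on_fst continuous_on_snd continuous_on_Im continuous_on_id)
qed

lemma open_solutions:
  assumes "open N" shows "open (solutions \<tau> \<sigma> N)"
proof -
  let ?z = "\<lambda>p. fst (fst (fst (fst p)))" and ?e = "\<lambda>p. snd (fst (fst (fst p)))" and ?k = "\<lambda>p. snd (fst (fst p))"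
    and ?s = "\<lambda>p. snd (fst p)" and ?t = "\<lambda>p. fst (snd p)" and ?y = "\<lambda>p. fst (snd (snd p))"
    and ?a = "\<lambda>p. fst (snd (snd (snd p)))" and ?j = "\<lambda>p. snd (snd (snd (snd p)))"
  have eq: "solutions \<tau> \<sigma> N = (sheet N \<times> UNIV) \<inter> {p.
     Re (exp (?z p)) * ?s p - Im (exp (?z p)) * ?t p > 0 \<and> Im (exp (?z p)) + ?a p * ?s p > 0 \<and>
     \<tau> * (Re (exp (?z p)) * ?s p - Im (exp (?z p)) * ?t p + ?y p * Im (cnj (exp (?z p)) * (exp (?z p) * ?e p))
        + ?k p * (Re (exp (?z p) * ?e p) * ?s p - Im (exp (?z p) * ?e p) * ?t p)) > 0 \<and>
     ?j p * Re (exp (?z p) * (1 + of_real (?k p) * ?e p)) - \<sigma> * Im (exp (?z p) * (1 + of_real (?k p) * ?e p)) > 0}"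
    by (auto simp: solutions_def sheet_def)
  show ?thesis unfolding eq
    by (intro open_Int open_Times open_sheet assms open_UNIV open_Collect_conj open_Collect_less
        continuous_on_const continuous_on_add continuous_on_diff continuous_on_mult continuous_on_Re continuous_on_Im
        continuous_on_cnj continuous_on_exp continuous_on_of_real
        continuous_on_fst continuous_on_snd continuous_on_id)
qed

text \<open>
  First \<open>(t, y, a, j)\<close> is eliminated, all fibres being intersections of half-spaces, and then \<open>s\<close>.
\<close>
lemma contractible_solutions:
  assumes N: "N \<subseteq> reduced \<tau> \<sigma>" "open N" "contractible N" and \<tau>: "\<tau> \<in> {1, -1}"
  shows "contractible (solutions \<tau> \<sigma> N)"
proof (rule contractible_convex_fibres[OF open_solutions[OF N(2)]])
  fix p :: "((complex \<times> complex) \<times> real) \<times> real"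
  obtain z e k s where p: "p = (((z, e), k), s)" by (metis prod.exhaust)
  define r where "r = exp z"
  define d where "d = r * e"
  define w where "w = r * (1 + of_real k * e)"
  have iff: "(p, (t, y, a, j)) \<in> solutions \<tau> \<sigma> N \<longleftrightarrow> p \<in> sheet N \<and>
      Re r * s - Im r * t > 0 \<and> Im r + a * s > 0 \<and>
      \<tau> * (Re r * s - Im r * t + y * Im (cnj r * d) + k * (Re d * s - Im d * t)) > 0 \<and>
      j * Re w - \<sigma> * Im w > 0" for t y a j
    unfolding p solutions_def sheet_def mem_Collect_eq case_prod_conv r_def d_def w_def by blast
  have "{q. (p, q) \<in> solutions \<tau> \<sigma> N} = (if p \<in> sheet N then
      {q. inner (- Im r, 0, 0, 0) q > - (Re r * s)} \<inter> ({q. inner (0, 0, s, 0) q > - Im r} \<inter>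
      ({q. inner (\<tau> * (- Im r - k * Im d), \<tau> * Im (cnj r * d), 0, 0) q > - (\<tau> * (Re r * s + k * Re d * s))} \<inter>
       {q. inner (0, 0, 0, Re w) q > \<sigma> * Im w})) else {})"
  proof -
    have "(p, (t, y, a, j)) \<in> solutions \<tau> \<sigma> N \<longleftrightarrow> p \<in> sheet N \<and>
      - (Im r * t) > - (Re r * s) \<and> s * a > - Im r \<and>
      \<tau> * (- Im r - k * Im d) * t + \<tau> * Im (cnj r * d) * y > - (\<tau> * (Re r * s + k * Re d * s)) \<and>
      Re w * j > \<sigma> * Im w" for t y a j
    proof -
      have "\<tau> * (Re r * s - Im r * t + y * Im (cnj r * d) + k * (Re d * s - Im d * t)) =
        \<tau> * (- Im r - k * Im d) * t + \<tau> * Im (cnj r * d) * y + \<tau> * (Re r * s + k * Re d * s)"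
        by (simp add: algebra_simps)
      then show ?thesis unfolding iff by (simp only: mult.commute[of j] mult.commute[of a]) linarith
    qed
    then show ?thesis by (auto simp: inner_prod_def simp del: times_complex.sel)
  qed
  then show "convex {q. (p, q) \<in> solutions \<tau> \<sigma> N}"
    by (simp only: split: if_split) (intro conjI impI convex_Int convex_halfspace_gt convex_empty)
next
  have "contractible (sheet N)"
  proof (rule contractible_convex_fibres[OF open_sheet[OF N(2)]])
    fix p :: "(complex \<times> complex) \<times> real"
    obtain z e k where p: "p = ((z, e), k)" by (metis prod.exhaust)
    have "is_interval {s. (p, s) \<in> sheet N}"
      by (auto simp: is_interval_1 sheet_def p)
    then show "convex {s. (p, s) \<in> sheet N}" by (simp only: is_interval_convex_1)
  next
    have "q \<in> fst ` sheet N" if "q \<in> N" for q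
    proof -
      obtain z e k where q: "q = ((z, e), k)" by (metis prod.exhaust)
      have "\<exists>s::real. (s > 0 \<or> Im z > 0) \<and> (s < 0 \<or> Im z < pi)" by (rule ex_sheet)
      then show ?thesis using that by (force simp: sheet_def q image_iff)
    qed
    then have "fst ` sheet N = N" by (force simp: sheet_def)
    then show "contractible (fst ` sheet N)" using N(3) by (simp only:)
  qed
  then show "contractible (fst ` solutions \<tau> \<sigma> N)" by (simp only: fst_solutions[OF N(1) \<tau>])
qed

lemma solutions_nonempty:
  assumes N: "N \<subseteq> reduced \<tau> \<sigma>" "N \<noteq> {}" and \<tau>: "\<tau> \<in> {1, -1}"
  shows "solutions \<tau> \<sigma> N \<noteq> {}"
proof -
  obtain z e k where q: "((z, e), k) \<in> N" using N(2) by auto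
  have "\<exists>s::real. (s > 0 \<or> Im z > 0) \<and> (s < 0 \<or> Im z < pi)" by (rule ex_sheet)
  then have "sheet N \<noteq> {}" using q by (auto simp: sheet_def)
  then show ?thesis using fst_solutions[OF N(1) \<tau>] by auto
qed

section \<open>Coordinates on the sign cells\<close>

text \<open>
  The logarithm with imaginary part in \<open>(- \<pi>, \<pi>)\<close> for \<open>s > 0\<close> and in \<open>(0, 2 \<pi>)\<close> otherwise, where it is
  used.  On the upper half-plane the two branches agree, so that \<open>s\<close> can change its sign there.
\<close>
definition lifted_log :: "complex \<Rightarrow> real \<Rightarrow> complex" where
  "lifted_log r s = (if s > 0 then Ln r else Ln (- r) + \<i> * of_real pi)"

lemma lifted_log_exp:
  assumes "- pi < Im z" "Im z < 2 * pi" "s > 0 \<or> Im z > 0" "s < 0 \<or> Im z < pi"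
  shows "lifted_log (exp z) s = z"
proof (cases "s > 0")
  case True
  then have "Im z < pi" using assms by auto
  then show ?thesis using True assms by (simp add: lifted_log_def)
next
  case False
  have "- exp z = exp (z - \<i> * of_real pi)" by (simp add: exp_diff mult.commute[of \<i>])
  moreover have "Ln (exp (z - \<i> * of_real pi)) = z - \<i> * of_real pi"
    using False assms by (intro Ln_exp) auto
  ultimately show ?thesis using False by (simp add: lifted_log_def)
qed

lemma exp_lifted_log: "r \<noteq> 0 \<Longrightarrow> exp (lifted_log r s) = r"
  by (simp add: lifted_log_def exp_add mult.commute[of \<i>])

lemma lifted_log_bounds:
  assumes "Im r = 0 \<Longrightarrow> Re r * s > 0" "s = 0 \<Longrightarrow> Im r > 0"
  shows "- pi < Im (lifted_log r s)" "Im (lifted_log r s) < 2 * pi" "s > 0 \<or> Im (lifted_log r s) > 0" "s < 0 \<or> Im (lifted_log r s) < pi"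
proof -
  have "- pi < Im (lifted_log r s) \<and> Im (lifted_log r s) < 2 * pi \<and> (s > 0 \<or> Im (lifted_log r s) > 0) \<and> (s < 0 \<or> Im (lifted_log r s) < pi)"
  proof (cases "s > 0")
    case True
    then have "r \<notin> \<real>\<^sub>\<le>\<^sub>0" using assms by (auto simp: complex_nonpos_Reals_iff zero_less_mult_iff)
    from Ln_slit_bounds[OF this] True show ?thesis by (auto simp: lifted_log_def)
  next
    case False
    then have r: "- r \<notin> \<real>\<^sub>\<le>\<^sub>0" using assms by (auto simp: complex_nonpos_Reals_iff zero_less_mult_iff)
    have "s = 0 \<Longrightarrow> Im (Ln (- r)) < 0"
      using assms(2) Im_Ln_pos_le[of "- r"] Ln_slit_bounds[OF r] by auto
    with Ln_slit_bounds[OF r] False show ?thesis by (cases "s = 0") (auto simp: lifted_log_def)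
  qed
  then show "- pi < Im (lifted_log r s)" "Im (lifted_log r s) < 2 * pi" "s > 0 \<or> Im (lifted_log r s) > 0" "s < 0 \<or> Im (lifted_log r s) < pi"
    by auto
qed

lemma continuous_lifted_log:
  "continuous_on {(r, s). (Im r = 0 \<longrightarrow> Re r * s > 0) \<and> (s = 0 \<longrightarrow> Im r > 0)} (\<lambda>(r, s). lifted_log r s)"
proof -
  let ?V1 = "{p :: complex \<times> real. (snd p > 0 \<and> fst p \<in> - \<real>\<^sub>\<le>\<^sub>0) \<or> Im (fst p) > 0}"
  let ?V2 = "{p :: complex \<times> real. (snd p < 0 \<and> - fst p \<in> - \<real>\<^sub>\<le>\<^sub>0) \<or> Im (fst p) > 0}"
  have o: "open (- \<real>\<^sub>\<le>\<^sub>0 :: complex set)" by (simp add: open_Compl closed_nonpos_Reals_complex)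
  have os: "open {p :: complex \<times> real. fst p \<in> - \<real>\<^sub>\<le>\<^sub>0}" "open {p :: complex \<times> real. - fst p \<in> - \<real>\<^sub>\<le>\<^sub>0}"
    using open_vimage[OF o, of "fst :: complex \<times> real \<Rightarrow> complex"] open_vimage[OF o, of "\<lambda>p :: complex \<times> real. - fst p"]
    by (simp_all add: vimage_def continuous_on_fst continuous_on_minus)
  have o1: "open ?V1" and o2: "open ?V2"
    by (intro open_Collect_conj open_Collect_disj os open_Collect_less continuous_on_const continuous_on_fst
        continuous_on_snd continuous_on_Im continuous_on_id)+
  have c1: "continuous_on ?V1 (\<lambda>p. Ln (fst p))"
    by (rule continuous_on_Ln'[OF continuous_on_fst[OF continuous_on_id]]) (auto simp: complex_nonpos_Reals_iff)
  have "continuous_on ?V2 (\<lambda>p. Ln (- fst p))"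
    by (rule continuous_on_Ln'[OF continuous_on_minus[OF continuous_on_fst[OF continuous_on_id]]])
       (auto simp: complex_nonpos_Reals_iff)
  then have c2: "continuous_on ?V2 (\<lambda>p. Ln (- fst p) + \<i> * of_real pi)"
    by (intro continuous_on_add continuous_on_const)
  have up: "Ln (- r) + \<i> * of_real pi = Ln r" if "Im r > 0" for r
    using that Ln_minus[of r] by (cases "r = 0") (auto simp: not_less)
  have l1: "lifted_log (fst p) (snd p) = Ln (fst p)" if "p \<in> ?V1" for p
    using that up by (auto simp: lifted_log_def)
  have l2: "lifted_log (fst p) (snd p) = Ln (- fst p) + \<i> * of_real pi" if "p \<in> ?V2" for p
    using that up by (auto simp: lifted_log_def)
  have "continuous_on ?V1 (\<lambda>p. lifted_log (fst p) (snd p))" "continuous_on ?V2 (\<lambda>p. lifted_log (fst p) (snd p))"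
    using iffD2[OF continuous_on_cong[OF refl l1] c1] iffD2[OF continuous_on_cong[OF refl l2] c2] by blast+
  then have "continuous_on (?V1 \<union> ?V2) (\<lambda>p. lifted_log (fst p) (snd p))"
    by (rule continuous_on_open_Un[OF o1 o2])
  then show ?thesis
    unfolding case_prod_unfold
    by (rule continuous_on_subset) (auto simp: complex_nonpos_Reals_iff zero_less_mult_iff)
qed

definition Lo1_matrix :: "real \<Rightarrow> real \<Rightarrow> real \<Rightarrow> real \<Rightarrow> real \<Rightarrow> real \<Rightarrow> real \<Rightarrow> real \<Rightarrow> real \<Rightarrow> real \<Rightarrow> 5 rmat" where
  "Lo1_matrix a b c d e f g h i j = (\<chi> r s. if r = s then 1 else
     if r = 1 \<and> s = 0 then a else if r = 2 \<and> s = 0 then b else if r = 2 \<and> s = 1 then c else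
     if r = 3 \<and> s = 0 then d else if r = 3 \<and> s = 1 then e else if r = 3 \<and> s = 2 then f else
     if r = 4 \<and> s = 0 then g else if r = 4 \<and> s = 1 then h else if r = 4 \<and> s = 2 then i else
     if r = 4 \<and> s = 3 then j else 0)"

lemma Lo1_matrix_entries:
  "Lo1_matrix a b c d e f g h i j $ 1 $ 0 = a" "Lo1_matrix a b c d e f g h i j $ 2 $ 0 = b" "Lo1_matrix a b c d e f g h i j $ 2 $ 1 = c"
  "Lo1_matrix a b c d e f g h i j $ 3 $ 0 = d" "Lo1_matrix a b c d e f g h i j $ 3 $ 1 = e" "Lo1_matrix a b c d e f g h i j $ 3 $ 2 = f"
  "Lo1_matrix a b c d e f g h i j $ 4 $ 0 = g" "Lo1_matrix a b c d e f g h i j $ 4 $ 1 = h" "Lo1_matrix a b c d e f g h i j $ 4 $ 2 = i"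
  "Lo1_matrix a b c d e f g h i j $ 4 $ 3 = j"
  by (simp_all add: Lo1_matrix_def)

lemma Lo1_matrix_in_Lo1: "Lo1_matrix a b c d e f g h i j \<in> Lo1"
  by (simp add: Lo1_def forall_5 less_5 Lo1_matrix_def)

lemma Lo1_eq_matrix:
  assumes "L \<in> Lo1"
  shows "L = Lo1_matrix (L$1$0) (L$2$0) (L$2$1) (L$3$0) (L$3$1) (L$3$2) (L$4$0) (L$4$1) (L$4$2) (L$4$3)"
  using assms by (simp add: Lo1_def vec_eq_iff forall_5 less_5 Lo1_matrix_def)

text \<open>
  Subtracting \<open>a = L$1$0\<close> times the second column from the first, and clearing the third column below its
  unit entry by row operations, does not change the minors.
\<close>
lemma minors_Lo1:
  fixes L :: "5 rmat"
  assumes "L \<in> Lo1"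
  defines "x3 \<equiv> L$2$0 - L$1$0 * L$2$1" and "x4 \<equiv> L$3$0 - L$1$0 * L$3$1" and "x5 \<equiv> L$4$0 - L$1$0 * L$4$1"
  shows "minor1 L = x5 + L$1$0 * L$4$1"
    and "minor2 L = x4 * L$4$1 - x5 * L$3$1"
    and "minor3 L = (x4 - L$3$2 * x3) * (L$4$1 - L$4$2 * L$2$1) - (x5 - L$4$2 * x3) * (L$3$1 - L$3$2 * L$2$1)"
    and "minor4 L = L$4$3 * (x4 - L$3$2 * x3) - (x5 - L$4$2 * x3)"
proof -
  have z: "L$1$1 = 1" "L$2$2 = 1" "L$3$3 = 1" "L$1$2 = 0" "L$1$3 = 0" "L$2$3 = 0"
    using assms(1) less_5 by (auto simp: Lo1_def)
  show "minor1 L = x5 + L$1$0 * L$4$1" by (simp add: minor1_def x5_def)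
  show "minor2 L = x4 * L$4$1 - x5 * L$3$1" by (simp add: minor2_def x4_def x5_def algebra_simps)
  show "minor3 L = (x4 - L$3$2 * x3) * (L$4$1 - L$4$2 * L$2$1) - (x5 - L$4$2 * x3) * (L$3$1 - L$3$2 * L$2$1)"
    by (simp add: minor3_def z x3_def x4_def x5_def algebra_simps)
  show "minor4 L = L$4$3 * (x4 - L$3$2 * x3) - (x5 - L$4$2 * x3)"
    by (simp add: minor4_def z x3_def x4_def x5_def algebra_simps)
qed

text \<open>
  The sign \<open>\<tau>\<close> is that of the product of the second and the third minor, since \<open>\<epsilon>\<close> is that of the second.
\<close>
definition sign_cell :: "real \<Rightarrow> real \<Rightarrow> real \<Rightarrow> real \<Rightarrow> 5 rmat set" where
  "sign_cell \<alpha> \<epsilon> \<tau> \<delta> = {L \<in> Lo1. \<alpha> * minor1 L > 0 \<and> \<epsilon> * minor2 L > 0 \<and> \<tau> * (\<epsilon> * minor3 L) > 0 \<and> \<delta> * minor4 L > 0}"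

text \<open>
  Up to the sign of \<open>L$4$3\<close> the signs are those of a conjugation by the diagonal matrix with entries
  \<open>1, \<alpha> \<epsilon>, 1, 1, \<alpha>\<close>.  They make the signed minors independent of \<open>\<epsilon>\<close>, and dependent on \<open>\<alpha>\<close> and \<open>\<delta>\<close>
  only through their product.
\<close>
definition matrix_of :: "real \<Rightarrow> real \<Rightarrow> real \<Rightarrow> (((complex \<times> complex) \<times> real) \<times> real) \<times> (real \<times> real \<times> real \<times> real) \<Rightarrow> 5 rmat" where
  "matrix_of \<alpha> \<epsilon> \<delta> = (\<lambda>((((z, e), k), s), (t, y, a, j)).
     Lo1_matrix (\<alpha> * \<epsilon> * a)
       (k + a * y) (\<epsilon> * \<alpha> * y)
       (Re (exp z) + a * t) (\<epsilon> * \<alpha> * t) (- Re (exp z * e))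
       (\<alpha> * (Im (exp z) + a * s)) (\<epsilon> * s) (- (\<alpha> * Im (exp z * e))) (\<delta> * j))"

definition coords_of :: "real \<Rightarrow> real \<Rightarrow> real \<Rightarrow> 5 rmat \<Rightarrow> (((complex \<times> complex) \<times> real) \<times> real) \<times> (real \<times> real \<times> real \<times> real)" where
  "coords_of \<alpha> \<epsilon> \<delta> L = (let r = Complex (L$3$0 - L$1$0 * L$3$1) (\<alpha> * (L$4$0 - L$1$0 * L$4$1)) in
     ((((lifted_log r (\<epsilon> * L$4$1), Complex (- L$3$2) (- (\<alpha> * L$4$2)) / r), L$2$0 - L$1$0 * L$2$1), \<epsilon> * L$4$1),
       (\<epsilon> * \<alpha> * L$3$1, \<epsilon> * \<alpha> * L$2$1, \<alpha> * \<epsilon> * L$1$0, \<delta> * L$4$3)))"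

abbreviation is_sign :: "real \<Rightarrow> bool" where "is_sign x \<equiv> x \<in> {1, -1}"

lemma matrix_of_in_sign_cell:
  assumes sg: "is_sign \<alpha>" "is_sign \<epsilon>" "is_sign \<delta>" and p: "p \<in> solutions \<tau> (\<delta> * \<alpha>) N"
  shows "matrix_of \<alpha> \<epsilon> \<delta> p \<in> sign_cell \<alpha> \<epsilon> \<tau> \<delta>"
proof -
  obtain z e k s t y a j where pe: "p = ((((z, e), k), s), (t, y, a, j))" by (metis prod.exhaust)
  define r where "r = exp z"
  define d where "d = r * e"
  have w: "r * (1 + of_real k * e) = r + of_real k * d" by (simp add: d_def algebra_simps)
  have c: "Re r * s - Im r * t > 0" "Im r + a * s > 0"
      "\<tau> * (Re r * s - Im r * t + y * Im (cnj r * d) + k * (Re d * s - Im d * t)) > 0"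
      "j * (Re r + k * Re d) - \<delta> * \<alpha> * (Im r + k * Im d) > 0"
    using p unfolding pe solutions_def mem_Collect_eq case_prod_conv r_def[symmetric] d_def[symmetric] w by simp_all
  define L where "L = matrix_of \<alpha> \<epsilon> \<delta> p"
  have L: "L = Lo1_matrix (\<alpha> * \<epsilon> * a) (k + a * y) (\<epsilon> * \<alpha> * y)
       (Re r + a * t) (\<epsilon> * \<alpha> * t) (- Re d)
       (\<alpha> * (Im r + a * s)) (\<epsilon> * s) (- (\<alpha> * Im d)) (\<delta> * j)"
    unfolding L_def matrix_of_def pe r_def d_def by (simp only: case_prod_conv)
  have L1: "L \<in> Lo1" unfolding L by (rule Lo1_matrix_in_Lo1)
  have sq: "\<alpha> * \<alpha> = 1" "\<epsilon> * \<epsilon> = 1" "\<delta> * \<delta> = 1" using sg by auto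
  note e = Lo1_matrix_entries[of "\<alpha> * \<epsilon> * a" "k + a * y" "\<epsilon> * \<alpha> * y" "Re r + a * t" "\<epsilon> * \<alpha> * t" "- Re d"
      "\<alpha> * (Im r + a * s)" "\<epsilon> * s" "- (\<alpha> * Im d)" "\<delta> * j", folded L]
  note m = minors_Lo1[OF L1, unfolded e]
  have "\<alpha> * minor1 L = Im r + a * s"
    unfolding m using sg by auto
  moreover have "\<epsilon> * minor2 L = Re r * s - Im r * t"
    unfolding m using sg by (auto simp: algebra_simps)
  moreover have "\<epsilon> * minor3 L = Re r * s - Im r * t + y * Im (cnj r * d) + k * (Re d * s - Im d * t)"
    unfolding m using sg by (auto simp: algebra_simps)
  moreover have "\<delta> * minor4 L = j * (Re r + k * Re d) - \<delta> * \<alpha> * (Im r + k * Im d)"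
    unfolding m using sg by (auto simp: algebra_simps)
  ultimately show ?thesis using c L1 unfolding sign_cell_def L_def[symmetric] by simp
qed

lemma coords_of_matrix_of:
  assumes sg: "is_sign \<alpha>" "is_sign \<epsilon>" "is_sign \<delta>" and p: "p \<in> solutions \<tau> \<sigma> N" and N: "N \<subseteq> reduced \<tau> \<sigma>"
  shows "coords_of \<alpha> \<epsilon> \<delta> (matrix_of \<alpha> \<epsilon> \<delta> p) = p"
proof -
  obtain z e k s t y a j where pe: "p = ((((z, e), k), s), (t, y, a, j))" by (metis prod.exhaust)
  have "((z, e), k) \<in> reduced \<tau> \<sigma>" and s: "s > 0 \<or> Im z > 0" "s < 0 \<or> Im z < pi"
    using p N by (auto simp: pe solutions_def)
  then have z: "lifted_log (exp z) s = z" by (intro lifted_log_exp) (auto simp: reduced_def)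
  have L: "matrix_of \<alpha> \<epsilon> \<delta> p = Lo1_matrix (\<alpha> * \<epsilon> * a) (k + a * y) (\<epsilon> * \<alpha> * y)
       (Re (exp z) + a * t) (\<epsilon> * \<alpha> * t) (- Re (exp z * e))
       (\<alpha> * (Im (exp z) + a * s)) (\<epsilon> * s) (- (\<alpha> * Im (exp z * e))) (\<delta> * j)"
    unfolding matrix_of_def pe by (simp only: case_prod_conv)
  have r: "Complex (Re (exp z) + a * t - \<alpha> * \<epsilon> * a * (\<epsilon> * \<alpha> * t))
      (\<alpha> * (\<alpha> * (Im (exp z) + a * s) - \<alpha> * \<epsilon> * a * (\<epsilon> * s))) = exp z"
    using sg by (auto simp: complex_eq_iff algebra_simps)
  have d: "Complex (- (- Re (exp z * e))) (- (\<alpha> * - (\<alpha> * Im (exp z * e)))) = exp z * e"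
    using sg by (auto simp: complex_eq_iff)
  have s': "\<epsilon> * (\<epsilon> * s) = s" using sg by auto
  have "coords_of \<alpha> \<epsilon> \<delta> (matrix_of \<alpha> \<epsilon> \<delta> p) = ((((z, e), k), s), (t, y, a, j))"
    unfolding coords_of_def Let_def L Lo1_matrix_entries r d s' z
    using sg by auto
  then show ?thesis by (simp only: pe)
qed

lemma matrix_of_coords_of:
  assumes sg: "is_sign \<alpha>" "is_sign \<epsilon>" "is_sign \<delta>" and L: "L \<in> sign_cell \<alpha> \<epsilon> \<tau> \<delta>"
  shows "matrix_of \<alpha> \<epsilon> \<delta> (coords_of \<alpha> \<epsilon> \<delta> L) = L"
    and "coords_of \<alpha> \<epsilon> \<delta> L \<in> solutions \<tau> (\<delta> * \<alpha>) (reduced \<tau> (\<delta> * \<alpha>))"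
proof -
  define x3 x4 x5 where "x3 = L$2$0 - L$1$0 * L$2$1" and "x4 = L$3$0 - L$1$0 * L$3$1" and "x5 = L$4$0 - L$1$0 * L$4$1"
  define r where "r = Complex x4 (\<alpha> * x5)"
  define d where "d = Complex (- L$3$2) (- (\<alpha> * L$4$2))"
  define e where "e = d / r"
  define s where "s = \<epsilon> * L$4$1"
  define z where "z = lifted_log r s"
  define t y a j where "t = \<epsilon> * \<alpha> * L$3$1" and "y = \<epsilon> * \<alpha> * L$2$1" and "a = \<alpha> * \<epsilon> * L$1$0" and "j = \<delta> * L$4$3"
  define k where "k = x3"
  have coords_of: "coords_of \<alpha> \<epsilon> \<delta> L = ((((z, e), k), s), (t, y, a, j))"
    unfolding coords_of_def Let_def z_def e_def k_def d_def r_def x3_def x4_def x5_def s_def t_def y_def a_def j_def ..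
  have L1: "L \<in> Lo1" and c: "\<alpha> * minor1 L > 0" "\<epsilon> * minor2 L > 0" "\<tau> * (\<epsilon> * minor3 L) > 0" "\<delta> * minor4 L > 0"
    using L by (auto simp: sign_cell_def)
  note m = minors_Lo1[OF L1, folded x3_def x4_def x5_def]
  have "\<alpha> * minor1 L = Im r + a * s"
    unfolding m r_def a_def s_def using sg by (auto simp: algebra_simps)
  with c have 1: "Im r + a * s > 0" by simp
  have "\<epsilon> * minor2 L = Re r * s - Im r * t"
    unfolding m r_def t_def s_def using sg by (auto simp: algebra_simps)
  with c have 2: "Re r * s - Im r * t > 0" by simp
  have "\<epsilon> * minor3 L = Re r * s - Im r * t + y * Im (cnj r * d) + k * (Re d * s - Im d * t)"
    unfolding m r_def t_def s_def y_def d_def k_def using sg by (auto simp: algebra_simps)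
  with c have 3: "\<tau> * (Re r * s - Im r * t + y * Im (cnj r * d) + k * (Re d * s - Im d * t)) > 0" by simp
  have "\<delta> * minor4 L = j * Re (r + of_real k * d) - \<delta> * \<alpha> * Im (r + of_real k * d)"
    unfolding m r_def j_def d_def k_def using sg by (auto simp: algebra_simps)
  with c have 4: "j * Re (r + of_real k * d) - \<delta> * \<alpha> * Im (r + of_real k * d) > 0" by simp
  have r0: "r \<noteq> 0" using 2 by auto
  have ez: "exp z = r" using r0 by (simp add: z_def exp_lifted_log)
  have re: "r * e = d" using r0 by (simp add: e_def)
  have w: "r * (1 + of_real k * e) = r + of_real k * d" by (simp add: re[symmetric] algebra_simps)
  have b: "- pi < Im z" "Im z < 2 * pi" "s > 0 \<or> Im z > 0" "s < 0 \<or> Im z < pi"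
    unfolding z_def using 1 2 by (intro lifted_log_bounds; force)+
  have b3: "\<not> (Im e = 0 \<and> \<tau> * (1 + k * Re e) \<le> 0)"
  proof
    assume *: "Im e = 0 \<and> \<tau> * (1 + k * Re e) \<le> 0"
    have "Re r * s - Im r * t + y * Im (cnj r * d) + k * (Re d * s - Im d * t) = (1 + k * Re e) * (Re r * s - Im r * t)"
      unfolding re[symmetric] using * by (simp add: algebra_simps)
    then have "\<tau> * (1 + k * Re e) * (Re r * s - Im r * t) > 0" using 3 by (simp add: mult.assoc)
    from zero_less_mult_pos2[OF this 2] show False using * by simp
  qed
  have b4: "\<not> (Re (r + of_real k * d) = 0 \<and> \<delta> * \<alpha> * Im (r + of_real k * d) \<ge> 0)"
    using 4 by auto
  have "((z, e), k) \<in> reduced \<tau> (\<delta> * \<alpha>)"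
    unfolding reduced_def mem_Collect_eq case_prod_conv ez w using b b3 b4 by blast
  then show "coords_of \<alpha> \<epsilon> \<delta> L \<in> solutions \<tau> (\<delta> * \<alpha>) (reduced \<tau> (\<delta> * \<alpha>))"
    unfolding coords_of solutions_def mem_Collect_eq case_prod_conv ez re w using b 1 2 3 4 by blast
  have sq: "\<alpha> * (\<alpha> * u) = u" "\<epsilon> * (\<epsilon> * u) = u" "\<delta> * (\<delta> * u) = u" for u using sg by auto
  have "matrix_of \<alpha> \<epsilon> \<delta> (coords_of \<alpha> \<epsilon> \<delta> L) = Lo1_matrix (\<alpha> * \<epsilon> * a) (k + a * y) (\<epsilon> * \<alpha> * y) (Re r + a * t) (\<epsilon> * \<alpha> * t) (- Re d)
       (\<alpha> * (Im r + a * s)) (\<epsilon> * s) (- (\<alpha> * Im d)) (\<delta> * j)"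
    unfolding coords_of matrix_of_def case_prod_conv ez re ..
  also have "\<dots> = Lo1_matrix (L$1$0) (L$2$0) (L$2$1) (L$3$0) (L$3$1) (L$3$2) (L$4$0) (L$4$1) (L$4$2) (L$4$3)"
  proof -
    have "\<alpha> * \<epsilon> * a = L$1$0" "\<epsilon> * \<alpha> * y = L$2$1" "\<epsilon> * \<alpha> * t = L$3$1" "\<epsilon> * s = L$4$1" "\<delta> * j = L$4$3"
      using sg by (auto simp: a_def y_def t_def s_def j_def)
    moreover have "k + a * y = L$2$0" "Re r + a * t = L$3$0" "\<alpha> * (Im r + a * s) = L$4$0"
      using sg by (auto simp: k_def a_def y_def t_def s_def r_def x3_def x4_def x5_def algebra_simps)
    moreover have "- Re d = L$3$2" "- (\<alpha> * Im d) = L$4$2" using sg by (auto simp: d_def)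
    ultimately show ?thesis by (simp only:)
  qed
  also have "\<dots> = L" by (rule Lo1_eq_matrix[OF L1, symmetric])
  finally show "matrix_of \<alpha> \<epsilon> \<delta> (coords_of \<alpha> \<epsilon> \<delta> L) = L" .
qed

section \<open>The count\<close>

lemma continuous_on_if_const:
  "(b \<Longrightarrow> continuous_on A f) \<Longrightarrow> (\<not> b \<Longrightarrow> continuous_on A g) \<Longrightarrow> continuous_on A (\<lambda>x. if b then f x else g x)"
  by (cases b) simp_all

lemma continuous_matrix_of: "continuous_on A (matrix_of \<alpha> \<epsilon> \<delta>)"
proof -
  let ?z = "\<lambda>p. fst (fst (fst (fst p)))" and ?e = "\<lambda>p. snd (fst (fst (fst p)))" and ?k = "\<lambda>p. snd (fst (fst p))"
    and ?s = "\<lambda>p. snd (fst p)" and ?t = "\<lambda>p. fst (snd p)" and ?y = "\<lambda>p. fst (snd (snd p))"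
    and ?a = "\<lambda>p. fst (snd (snd (snd p)))" and ?j = "\<lambda>p. snd (snd (snd (snd p)))"
  have eq: "matrix_of \<alpha> \<epsilon> \<delta> = (\<lambda>p. Lo1_matrix (\<alpha> * \<epsilon> * ?a p)
       (?k p + ?a p * ?y p) (\<epsilon> * \<alpha> * ?y p)
       (Re (exp (?z p)) + ?a p * ?t p) (\<epsilon> * \<alpha> * ?t p) (- Re (exp (?z p) * ?e p))
       (\<alpha> * (Im (exp (?z p)) + ?a p * ?s p)) (\<epsilon> * ?s p) (- (\<alpha> * Im (exp (?z p) * ?e p))) (\<delta> * ?j p))"
    by (simp add: matrix_of_def case_prod_unfold)
  have lo: "continuous_on A (\<lambda>p. Lo1_matrix (fa p) (fb p) (fc p) (fd p) (fe p) (ff p) (fg p) (fh p) (fi p) (fj p))"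
    if "continuous_on A fa" "continuous_on A fb" "continuous_on A fc" "continuous_on A fd" "continuous_on A fe"
      "continuous_on A ff" "continuous_on A fg" "continuous_on A fh" "continuous_on A fi" "continuous_on A fj"
    for fa fb fc fd fe ff fg fh fi fj
    unfolding Lo1_matrix_def
    by (intro continuous_on_vec_lambda continuous_on_if_const continuous_on_const that)
  show ?thesis unfolding eq
    by (intro lo continuous_on_const continuous_on_add continuous_on_minus continuous_on_mult continuous_on_Re
        continuous_on_Im continuous_on_exp continuous_on_fst continuous_on_snd continuous_on_id)
qed

lemma continuous_coords_of:
  assumes sg: "is_sign \<alpha>" "is_sign \<epsilon>" "is_sign \<delta>"
  shows "continuous_on (sign_cell \<alpha> \<epsilon> \<tau> \<delta>) (coords_of \<alpha> \<epsilon> \<delta>)"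
proof -
  let ?C = "sign_cell \<alpha> \<epsilon> \<tau> \<delta>"
  define r where "r = (\<lambda>L :: 5 rmat. Complex (L$3$0 - L$1$0 * L$3$1) (\<alpha> * (L$4$0 - L$1$0 * L$4$1)))"
  define s where "s = (\<lambda>L :: 5 rmat. \<epsilon> * L$4$1)"
  have comp: "continuous_on ?C (\<lambda>L. L $ i $ j)" for i j :: 5
    by (intro continuous_on_component continuous_on_id)
  have cr: "continuous_on ?C r" unfolding r_def
    by (intro continuous_on_Complex continuous_on_mult continuous_on_diff continuous_on_const comp)
  have cs: "continuous_on ?C s" unfolding s_def
    by (intro continuous_on_mult continuous_on_const comp)
  have V: "(Im (r L) = 0 \<longrightarrow> Re (r L) * s L > 0) \<and> (s L = 0 \<longrightarrow> Im (r L) > 0)" if L: "L \<in> ?C" for L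
  proof -
    have L1: "L \<in> Lo1" and c: "\<alpha> * minor1 L > 0" "\<epsilon> * minor2 L > 0" using L by (auto simp: sign_cell_def)
    have "\<alpha> * minor1 L = Im (r L) + \<alpha> * \<epsilon> * L$1$0 * s L"
      unfolding minors_Lo1[OF L1] r_def s_def using sg by (auto simp: algebra_simps)
    moreover have "\<epsilon> * minor2 L = Re (r L) * s L - Im (r L) * (\<epsilon> * \<alpha> * L$3$1)"
      unfolding minors_Lo1[OF L1] r_def s_def using sg by (auto simp: algebra_simps)
    ultimately show ?thesis using c by auto
  qed
  then have r0: "r L \<noteq> 0" if "L \<in> ?C" for L using V[OF that] by auto
  have "continuous_on ?C (\<lambda>L. (r L, s L))" using cr cs by (rule continuous_on_Pair)
  then have cl: "continuous_on ?C (\<lambda>L. (\<lambda>(r, s). lifted_log r s) (r L, s L))"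
    by (rule continuous_on_compose2[OF continuous_lifted_log]) (use V in auto)
  have cd: "continuous_on ?C (\<lambda>L. Complex (- L$3$2) (- (\<alpha> * L$4$2)) / r L)"
    by (intro continuous_on_divide continuous_on_Complex continuous_on_minus continuous_on_mult continuous_on_const comp cr)
       (use r0 in auto)
  have eq: "coords_of \<alpha> \<epsilon> \<delta> = (\<lambda>L. ((((lifted_log (r L) (s L), Complex (- L$3$2) (- (\<alpha> * L$4$2)) / r L), L$2$0 - L$1$0 * L$2$1), s L),
       (\<epsilon> * \<alpha> * L$3$1, \<epsilon> * \<alpha> * L$2$1, \<alpha> * \<epsilon> * L$1$0, \<delta> * L$4$3)))"
    by (simp add: fun_eq_iff coords_of_def Let_def r_def s_def)
  show ?thesis unfolding eq
    by (intro continuous_on_Pair cl[unfolded case_prod_conv] cd cs continuous_on_diff continuous_on_mult continuous_on_const comp)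
qed

text \<open>
  The coordinates carry a partition of the reduced space to a partition of the sign cell; the part over
  \<open>N\<close> is homeomorphic to the solutions over \<open>N\<close>.
\<close>
lemma contractible_pieces_sign_cell:
  assumes sg: "is_sign \<alpha>" "is_sign \<epsilon>" "is_sign \<tau>" "is_sign \<delta>"
    and reduced: "contractible_pieces (reduced \<tau> (\<delta> * \<alpha>)) n" and ob: "open (reduced \<tau> (\<delta> * \<alpha>))"
  shows "contractible_pieces (sign_cell \<alpha> \<epsilon> \<tau> \<delta>) n"
proof -
  let ?C = "sign_cell \<alpha> \<epsilon> \<tau> \<delta>" and ?B = "reduced \<tau> (\<delta> * \<alpha>)"
  obtain F where F: "finite F" "card F = n" "disjoint F" "\<Union>F = ?B"
     "\<And>N. N \<in> F \<Longrightarrow> N \<noteq> {} \<and> contractible N \<and> openin (top_of_set ?B) N"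
    using reduced by (auto simp: contractible_pieces_def)
  have F': "open N" "N \<subseteq> ?B" "contractible N" "N \<noteq> {}" if "N \<in> F" for N
    using F(5)[OF that] ob openin_open_eq F(4) that by blast+
  let ?\<Phi> = "\<lambda>L. fst (fst (coords_of \<alpha> \<epsilon> \<delta> L))"
  define G where "G = (\<lambda>N. ?C \<inter> ?\<Phi> -` N)"
  have \<Phi>: "continuous_on ?C ?\<Phi>" by (intro continuous_on_fst continuous_coords_of sg)
  have \<Phi>B: "?\<Phi> L \<in> ?B" if "L \<in> ?C" for L
    using matrix_of_coords_of(2)[OF sg(1,2,4) that] by (auto simp: solutions_def)
  have mem: "fst (fst p) \<in> N" if "p \<in> solutions \<tau> (\<delta> * \<alpha>) N" for p N
    using that by (auto simp: solutions_def)
  have coords_of_solutions: "coords_of \<alpha> \<epsilon> \<delta> L \<in> solutions \<tau> (\<delta> * \<alpha>) N" if "L \<in> G N" for L N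
  proof -
    have "coords_of \<alpha> \<epsilon> \<delta> L \<in> solutions \<tau> (\<delta> * \<alpha>) ?B" "?\<Phi> L \<in> N"
      using matrix_of_coords_of(2)[OF sg(1,2,4)] that by (auto simp: G_def)
    then show ?thesis by (auto simp: solutions_def)
  qed
  have matrix_of_G: "matrix_of \<alpha> \<epsilon> \<delta> p \<in> G N" if p: "p \<in> solutions \<tau> (\<delta> * \<alpha>) N" and N: "N \<in> F" for p N
    using matrix_of_in_sign_cell[OF sg(1,2,4) p] coords_of_matrix_of[OF sg(1,2,4) p F'(2)[OF N]] mem[OF p] by (simp add: G_def)
  have cG: "contractible (G N)" if N: "N \<in> F" for N
  proof -
    have "G N homeomorphic solutions \<tau> (\<delta> * \<alpha>) N"
      unfolding homeomorphic_def
    proof (intro exI homeomorphismI)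
      show "continuous_on (G N) (coords_of \<alpha> \<epsilon> \<delta>)"
        by (rule continuous_on_subset[OF continuous_coords_of[OF sg(1,2,4)]]) (auto simp: G_def)
      show "continuous_on (solutions \<tau> (\<delta> * \<alpha>) N) (matrix_of \<alpha> \<epsilon> \<delta>)" by (rule continuous_matrix_of)
      show "coords_of \<alpha> \<epsilon> \<delta> ` G N \<subseteq> solutions \<tau> (\<delta> * \<alpha>) N" using coords_of_solutions by blast
      show "matrix_of \<alpha> \<epsilon> \<delta> ` solutions \<tau> (\<delta> * \<alpha>) N \<subseteq> G N" using matrix_of_G N by blast
      show "matrix_of \<alpha> \<epsilon> \<delta> (coords_of \<alpha> \<epsilon> \<delta> L) = L" if "L \<in> G N" for L
        using that by (intro matrix_of_coords_of(1)[OF sg(1,2,4), where \<tau> = \<tau>]) (simp add: G_def)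
      show "coords_of \<alpha> \<epsilon> \<delta> (matrix_of \<alpha> \<epsilon> \<delta> p) = p" if "p \<in> solutions \<tau> (\<delta> * \<alpha>) N" for p
        by (rule coords_of_matrix_of[OF sg(1,2,4) that F'(2)[OF N]])
    qed
    then show ?thesis
      using homeomorphic_contractible_eq contractible_solutions[OF F'(2,1,3)[OF N] sg(3)] by blast
  qed
  have neG: "G N \<noteq> {}" if N: "N \<in> F" for N
    using solutions_nonempty[OF F'(2,4)[OF N] sg(3)] matrix_of_G[OF _ N] by blast
  have djG: "G N \<inter> G N' = {}" if "N \<in> F" "N' \<in> F" "N \<noteq> N'" for N N'
    using disjointD[OF F(3) that] by (auto simp: G_def)
  have inj: "inj_on G F"
  proof (rule inj_onI, rule ccontr)
    fix N N' assume *: "N \<in> F" "N' \<in> F" "G N = G N'" "N \<noteq> N'"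
    then have "G N \<inter> G N' = {}" by (intro djG)
    then show False using neG[OF *(1)] *(3) by simp
  qed
  show ?thesis
    unfolding contractible_pieces_def
  proof (intro exI[of _ "G ` F"] conjI ballI)
    show "finite (G ` F)" using F(1) by simp
    show "card (G ` F) = n" using F(2) inj by (simp add: card_image)
    show "disjoint (G ` F)" using djG by (auto simp: disjoint_def)
    show "\<Union>(G ` F) = ?C" using \<Phi>B unfolding F(4)[symmetric] G_def by blast
    fix D assume "D \<in> G ` F"
    then obtain N where N: "N \<in> F" "D = G N" by blast
    show "D \<noteq> {}" "contractible D" using N neG cG by auto
    show "openin (top_of_set ?C) D"
      unfolding N G_def by (rule continuous_openin_preimage_gen[OF \<Phi> F'(1)[OF N(1)]])
  qed
qed

lemma open_reduced:
  assumes "is_sign \<tau>" "is_sign \<sigma>" shows "open (reduced \<tau> \<sigma>)"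
proof -
  consider "\<tau> = -1" | "\<tau> = 1" "\<sigma> = 1" | "\<tau> = 1" "\<sigma> = -1" using assms by auto
  then show ?thesis
  proof cases
    case 1 then show ?thesis using reduced_reflecting_eq[OF assms(2)] open_reflecting_piece by auto
  next
    case 2 then show ?thesis unfolding 2 reduced_direct_plus_eq by (intro open_Un open_window) auto
  next
    case 3 then show ?thesis unfolding 3 reduced_direct_minus_eq by (intro open_Un open_window) auto
  qed
qed

definition piece_count :: "real \<Rightarrow> real \<Rightarrow> nat" where
  "piece_count \<tau> \<sigma> = (if \<tau> = -1 then 2 else if \<sigma> = 1 then 6 else 3)"

lemma contractible_pieces_reduced:
  assumes "is_sign \<tau>" "is_sign \<sigma>" shows "contractible_pieces (reduced \<tau> \<sigma>) (piece_count \<tau> \<sigma>)"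
  using assms contractible_pieces_reduced_reflecting contractible_pieces_reduced_direct_plus contractible_pieces_reduced_direct_minus
  by (auto simp: piece_count_def)

lemma BL_eq_sign_cells:
  "BL \<eta> = (\<Union>(\<alpha>, \<epsilon>, \<tau>, \<delta>) \<in> {1, -1} \<times> {1, -1} \<times> {1, -1} \<times> {1, -1}. sign_cell \<alpha> \<epsilon> \<tau> \<delta>)"
proof -
  have sg: "is_sign (sgn x)" "sgn x * x > 0" if "x \<noteq> 0" for x :: real
    using that by (auto simp: sgn_if)
  have "L \<in> (\<Union>(\<alpha>, \<epsilon>, \<tau>, \<delta>) \<in> {1, -1} \<times> {1, -1} \<times> {1, -1} \<times> {1, -1}. sign_cell \<alpha> \<epsilon> \<tau> \<delta>)" if L: "L \<in> BL \<eta>" for L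
  proof -
    have L1: "L \<in> Lo1" and m: "minor1 L \<noteq> 0" "minor2 L \<noteq> 0" "minor3 L \<noteq> 0" "minor4 L \<noteq> 0"
      using L by (auto simp: BL_iff)
    have 3: "sgn (minor2 L) * minor3 L \<noteq> 0" using m by (simp add: sgn_0_0)
    let ?i = "(sgn (minor1 L), sgn (minor2 L), sgn (sgn (minor2 L) * minor3 L), sgn (minor4 L))"
    have "L \<in> sign_cell (sgn (minor1 L)) (sgn (minor2 L)) (sgn (sgn (minor2 L) * minor3 L)) (sgn (minor4 L))"
      unfolding sign_cell_def using L1 sg(2)[OF m(1)] sg(2)[OF m(2)] sg(2)[OF 3] sg(2)[OF m(4)] by blast
    then have "L \<in> (\<lambda>(\<alpha>, \<epsilon>, \<tau>, \<delta>). sign_cell \<alpha> \<epsilon> \<tau> \<delta>) ?i" by (simp only: case_prod_conv)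
    moreover have "?i \<in> {1, -1} \<times> {1, -1} \<times> {1, -1} \<times> {1, -1}"
      by (intro SigmaI sg(1) m 3)
    ultimately show ?thesis by (rule UN_I[rotated])
  qed
  moreover have "L \<in> BL \<eta>" if "L \<in> sign_cell \<alpha> \<epsilon> \<tau> \<delta>" for L \<alpha> \<epsilon> \<tau> \<delta>
    using that unfolding BL_iff sign_cell_def mem_Collect_eq by (metis less_irrefl mult_zero_right)
  then have "(\<Union>(\<alpha>, \<epsilon>, \<tau>, \<delta>) \<in> {1, -1} \<times> {1, -1} \<times> {1, -1} \<times> {1, -1}. sign_cell \<alpha> \<epsilon> \<tau> \<delta>) \<subseteq> BL \<eta>"
    unfolding case_prod_unfold by (intro UN_least subsetI)
  ultimately show ?thesis by (intro equalityI subsetI) (assumption | erule subsetD)+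
qed

lemma continuous_minors:
  "continuous_on A minor1" "continuous_on A minor2" "continuous_on A minor3" "continuous_on A minor4"
  unfolding minor1_def minor2_def minor3_def minor4_def
  by (intro continuous_on_component continuous_on_id continuous_on_add continuous_on_diff continuous_on_mult)+

lemma openin_sign_cell: "openin (top_of_set Lo1) (sign_cell \<alpha> \<epsilon> \<tau> \<delta>)"
proof -
  have "sign_cell \<alpha> \<epsilon> \<tau> \<delta> = Lo1 \<inter> {L. \<alpha> * minor1 L > 0 \<and> \<epsilon> * minor2 L > 0 \<and> \<tau> * (\<epsilon> * minor3 L) > 0 \<and> \<delta> * minor4 L > 0}"
    by (auto simp: sign_cell_def)
  moreover have "open {L. \<alpha> * minor1 L > 0 \<and> \<epsilon> * minor2 L > 0 \<and> \<tau> * (\<epsilon> * minor3 L) > 0 \<and> \<delta> * minor4 L > 0}"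
    by (intro open_Collect_conj open_Collect_less continuous_on_const continuous_on_mult continuous_minors)
  ultimately show ?thesis by (simp only: openin_open_Int)
qed

lemma contractible_pieces_BL: "contractible_pieces (BL \<eta>) 52"
proof -
  let ?S = "{1, -1 :: real}"
  let ?I = "?S \<times> ?S \<times> ?S \<times> ?S"
  let ?X = "\<lambda>(\<alpha>, \<epsilon>, \<tau>, \<delta>). sign_cell \<alpha> \<epsilon> \<tau> \<delta>" and ?n = "\<lambda>(\<alpha>, \<epsilon> :: real, \<tau>, \<delta>). piece_count \<tau> (\<delta> * \<alpha>)"
  have "contractible_pieces (\<Union>i\<in>?I. ?X i) (\<Sum>i\<in>?I. ?n i)"
  proof (rule contractible_pieces_UN)
    show "contractible_pieces (?X i) (?n i)" if i: "i \<in> ?I" for i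
    proof -
      obtain \<alpha> \<epsilon> \<tau> \<delta> where eq: "i = (\<alpha>, \<epsilon>, \<tau>, \<delta>)" and s: "is_sign \<alpha>" "is_sign \<epsilon>" "is_sign \<tau>" "is_sign \<delta>"
        using i by (metis mem_Times_iff prod.collapse)
      have "is_sign (\<delta> * \<alpha>)" using s by auto
      then show ?thesis unfolding eq case_prod_conv
        by (intro contractible_pieces_sign_cell s contractible_pieces_reduced open_reduced)
    qed
    show "openin (top_of_set (\<Union>i\<in>?I. ?X i)) (?X i)" if i: "i \<in> ?I" for i
    proof -
      have "openin (top_of_set Lo1) (?X i)" unfolding case_prod_unfold by (rule openin_sign_cell)
      moreover have "?X i \<subseteq> (\<Union>i\<in>?I. ?X i)" by (rule UN_upper[OF i])
      moreover have "(\<Union>i\<in>?I. ?X i) \<subseteq> Lo1"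
        unfolding case_prod_unfold sign_cell_def by (intro UN_least subsetI) (erule CollectE, erule conjunct1)
      ultimately show ?thesis by (rule openin_subset_trans)
    qed
    have eq: "\<alpha> = \<alpha>' \<and> \<epsilon> = \<epsilon>' \<and> \<tau> = \<tau>' \<and> \<delta> = \<delta>'"
      if "is_sign \<alpha>" "is_sign \<epsilon>" "is_sign \<tau>" "is_sign \<delta>" "is_sign \<alpha>'" "is_sign \<epsilon>'" "is_sign \<tau>'" "is_sign \<delta>'"
        and L: "L \<in> sign_cell \<alpha> \<epsilon> \<tau> \<delta>" "L \<in> sign_cell \<alpha>' \<epsilon>' \<tau>' \<delta>'" for L \<alpha> \<epsilon> \<tau> \<delta> \<alpha>' \<epsilon>' \<tau>' \<delta>'
    proof -
      have uni: "s = s'" if "is_sign s" "is_sign s'" "s * x > 0" "s' * x > 0" for s s' x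
        using that by auto
      have "\<alpha> = \<alpha>'" by (rule uni[OF that(1,5), of "minor1 L"]) (use L in \<open>simp_all add: sign_cell_def\<close>)
      moreover have "\<epsilon> = \<epsilon>'" by (rule uni[OF that(2,6), of "minor2 L"]) (use L in \<open>simp_all add: sign_cell_def\<close>)
      moreover from this have "\<tau> = \<tau>'"
        by (intro uni[OF that(3,7), of "\<epsilon> * minor3 L"]) (use L in \<open>simp_all add: sign_cell_def\<close>)
      moreover have "\<delta> = \<delta>'" by (rule uni[OF that(4,8), of "minor4 L"]) (use L in \<open>simp_all add: sign_cell_def\<close>)
      ultimately show ?thesis by blast
    qed
    show "disjoint_family_on ?X ?I"
      unfolding disjoint_family_on_def
    proof (intro ballI impI, rule ccontr)
      fix i i' assume i: "i \<in> ?I" and i': "i' \<in> ?I" and ne: "i \<noteq> i'" and "?X i \<inter> ?X i' \<noteq> {}"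
      then obtain L where L: "L \<in> ?X i" "L \<in> ?X i'" by blast
      obtain \<alpha> \<epsilon> \<tau> \<delta> where e: "i = (\<alpha>, \<epsilon>, \<tau>, \<delta>)" by (metis prod.exhaust)
      obtain \<alpha>' \<epsilon>' \<tau>' \<delta>' where e': "i' = (\<alpha>', \<epsilon>', \<tau>', \<delta>')" by (metis prod.exhaust)
      have s: "is_sign \<alpha>" "is_sign \<epsilon>" "is_sign \<tau>" "is_sign \<delta>" "is_sign \<alpha>'" "is_sign \<epsilon>'" "is_sign \<tau>'" "is_sign \<delta>'"
        using i i' unfolding e e' mem_Times_iff fst_conv snd_conv by blast+
      have "L \<in> sign_cell \<alpha> \<epsilon> \<tau> \<delta>" "L \<in> sign_cell \<alpha>' \<epsilon>' \<tau>' \<delta>'" using L unfolding e e' case_prod_conv by blast+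
      from eq[OF s this] show False using ne unfolding e e' by blast
    qed
  qed simp
  moreover have "(\<Sum>i\<in>?I. ?n i) = 52"
    by (simp add: sum.cartesian_product[symmetric] piece_count_def)
  ultimately show ?thesis by (simp only: BL_eq_sign_cells)
qed

theorem mainTheorem1:
  shows "card (components (BL \<eta>)) = 52 \<and>
    (\<forall>C \<in> components (BL \<eta>). contractible C)"
  by (rule contractible_pieces_components[OF contractible_pieces_BL])

end
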